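(* There is a uniform, deterministic algorithm in the parallel independence-oracle model that, for any graphic matroid on $m$ elements, finds a basis using $O(\log(m)\log\log(m))$ rounds, with $\mathrm{poly}(m)$ independence queries per round.
   Context: A graphic matroid on ground set $E$ ($|E|=m$) comes from an (unknown) graph $G=(V,E)$: a set $S\subseteq E$ is independent iff $S$ contains no cycle of $G$; a basis is an inclusion-maximal independent set (a spanning forest of $G$). The algorithm has access to the matroid only through an independence oracle $\mathrm{Ind}:2^E\to\{0,1\}$, $\mathrm{Ind}(S)=1$ iff $S$ is independent. It operates in rounds: in each round it submits a batch of queries (subsets of $E$), chosen as a function of $m$ and the answers received in previous rounds, and then receives all answers. Uniform and deterministic means the queries and output are computed by a single fixed explicit deterministic procedure (no randomness, no non-uniform advice). *)

theory Defs
  imports Complex_Main "HOL-Library.Nat_Bijection" "HOL-Library.Landau_Symbols"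
begin

section \<open>Graphic matroids\<close>

text \<open>Finite undirected multigraphs; loops (one endpoint) and parallel edges are allowed, so that
  every graphic matroid is covered.\<close>

record ('v, 'e) mgraph =
  verts :: "'v set"
  edges :: "'e set"
  ends :: "'e \<Rightarrow> 'v set"

definition wf_mgraph :: "('v, 'e) mgraph \<Rightarrow> bool" where
  "wf_mgraph G \<longleftrightarrow> finite (verts G) \<and> finite (edges G) \<and>
     (\<forall>e\<in>edges G. ends G e \<subseteq> verts G \<and> card (ends G e) \<in> {1, 2})"

text \<open>A cycle \<open>v\<^sub>0 e\<^sub>0 v\<^sub>1 e\<^sub>1 \<dots> v\<^sub>k\<^sub>-\<^sub>1 e\<^sub>k\<^sub>-\<^sub>1 v\<^sub>0\<close>; a loop is a cycle of length 1, two parallel edges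
  form a cycle of length 2.\<close>

definition is_cycle :: "('v, 'e) mgraph \<Rightarrow> 'v list \<Rightarrow> 'e list \<Rightarrow> bool" where
  "is_cycle G vs es \<longleftrightarrow>
     es \<noteq> [] \<and> length vs = length es \<and> distinct vs \<and> distinct es \<and>
     set vs \<subseteq> verts G \<and> set es \<subseteq> edges G \<and>
     (\<forall>i<length es. ends G (es ! i) = {vs ! i, vs ! (Suc i mod length es)})"

definition contains_cycle :: "('v, 'e) mgraph \<Rightarrow> 'e set \<Rightarrow> bool" where
  "contains_cycle G S \<longleftrightarrow> (\<exists>vs es. is_cycle G vs es \<and> set es \<subseteq> S)"

text \<open>\<open>Ind\<close> is the independence predicate of a graphic matroid on the ground set \<open>E\<close>. As graphs
  are finite, taking the vertices to be natural numbers is no restriction.\<close>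

definition graphic_matroid :: "'e set \<Rightarrow> ('e set \<Rightarrow> bool) \<Rightarrow> bool" where
  "graphic_matroid E Ind \<longleftrightarrow>
     (\<exists>G :: (nat, 'e) mgraph. wf_mgraph G \<and> edges G = E \<and>
        (\<forall>S. Ind S \<longleftrightarrow> S \<subseteq> E \<and> \<not> contains_cycle G S))"

definition matroid_basis :: "('e set \<Rightarrow> bool) \<Rightarrow> 'e set \<Rightarrow> bool" where
  "matroid_basis Ind B \<longleftrightarrow> Ind B \<and> (\<forall>S. Ind S \<and> B \<subseteq> S \<longrightarrow> S = B)"


section \<open>Computable functions\<close>

text \<open>The total (general) recursive functions: the least class of functions containing the basic
  functions and closed under composition, primitive recursion and minimisation of regular
  functions. Several arguments are passed through the Cantor pairing \<^const>\<open>prod_encode\<close>.\<close>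

inductive computable :: "(nat \<Rightarrow> nat) \<Rightarrow> bool" where
  computable_zero: "computable (\<lambda>_. 0)"
| computable_Suc: "computable Suc"
| computable_fst: "computable (\<lambda>x. fst (prod_decode x))"
| computable_snd: "computable (\<lambda>x. snd (prod_decode x))"
| computable_pair:
    "computable f \<Longrightarrow> computable g \<Longrightarrow> computable (\<lambda>x. prod_encode (f x, g x))"
| computable_comp:
    "computable f \<Longrightarrow> computable g \<Longrightarrow> computable (\<lambda>x. f (g x))"
| computable_rec:
    "computable f \<Longrightarrow> computable g \<Longrightarrow>
     computable (\<lambda>x. rec_nat (f (fst (prod_decode x)))
       (\<lambda>k r. g (prod_encode (fst (prod_decode x), prod_encode (k, r)))) (snd (prod_decode x)))"
| computable_min:
    "computable f \<Longrightarrow> (\<And>a. \<exists>n. f (prod_encode (a, n)) = 0) \<Longrightarrow>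
     computable (\<lambda>a. LEAST n. f (prod_encode (a, n)) = 0)"


section \<open>The parallel independence-oracle model\<close>

text \<open>The ground set of an instance of size \<open>m\<close> is \<open>{..<m}\<close>. Given \<open>m\<close> and the answers of all
  previous rounds (one list of answers per round), a deterministic algorithm either submits the
  next batch of queries or stops with an output.\<close>

datatype action = Query "nat set list" | Return "nat set"

type_synonym algorithm = "nat \<Rightarrow> bool list list \<Rightarrow> action"

text \<open>\<open>h\<close> is the complete transcript of the (unique) run on \<open>m\<close> elements with oracle \<open>Ind\<close>:
  \<open>length h\<close> is the number of rounds, \<open>length (h ! i)\<close> the number of queries in round \<open>i\<close>.\<close>

definition run :: "algorithm \<Rightarrow> nat \<Rightarrow> (nat set \<Rightarrow> bool) \<Rightarrow> bool list list \<Rightarrow> nat set \<Rightarrow> bool" where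
  "run A m Ind h B \<longleftrightarrow>
     (\<forall>i<length h. \<exists>qs. A m (take i h) = Query qs \<and> (\<forall>S\<in>set qs. S \<subseteq> {..<m}) \<and>
        h ! i = map Ind qs) \<and>
     A m h = Return B"

definition encode_input :: "nat \<Rightarrow> bool list list \<Rightarrow> nat" where
  "encode_input m h = prod_encode (m, list_encode (map (\<lambda>as. list_encode (map of_bool as)) h))"

definition decode_action :: "nat \<Rightarrow> action" where
  "decode_action c = (case sum_decode c of
       Inl b \<Rightarrow> Query (map set_decode (list_decode b))
     | Inr s \<Rightarrow> Return (set_decode s))"

text \<open>Uniformity: one computable function serves all sizes \<open>m\<close>. An arbitrary function of type
  \<^typ>\<open>algorithm\<close> could hide non-uniform advice in its dependence on \<open>m\<close>.\<close>

definition uniform :: "algorithm \<Rightarrow> bool" where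
  "uniform A \<longleftrightarrow> (\<exists>f. computable f \<and> (\<forall>m h. A m h = decode_action (f (encode_input m h))))"

end

theory Submission
  imports Defs "HOL-Probability.Product_PMF" "HOL-Real_Asymp.Real_Asymp"
begin

text \<open>The edges are processed in rounds; before a round the surviving edge set \<open>E\<close> has girth at least
  \<open>g\<close>. For every set \<open>S\<close> of a fixed family the round queries all sets \<open>E \<inter> S \<inter> {..<k}\<close>, and deletes \<open>e\<close>
  whenever \<open>E \<inter> S \<inter> {..<e}\<close> is independent but \<open>E \<inter> S \<inter> {..e}\<close> is not: then \<open>e\<close> is spanned by smaller
  edges, so all these deletions together preserve the span. A cycle \<open>C\<close> of length at most \<open>3 * g / 2\<close>
  loses its largest edge as soon as some \<open>S\<close> in the family contains \<open>C\<close>, but no cycle avoiding that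
  edge. Hence the girth grows by a factor \<open>3 / 2\<close> per round, and after \<open>O(log m)\<close> rounds the survivors
  form a basis.

  A random set that contains each edge with probability \<open>(2 * m) powr (- 58 / g)\<close> isolates a given \<open>C\<close>
  with probability at least \<open>1 / (2 * m) ^ 88\<close>, since a graph of girth \<open>g\<close> has only \<open>m\<close> to the power
  \<open>O(l / g)\<close> cycles of length \<open>l\<close>. There are only exponentially many graphs with \<open>m\<close> edges, so polynomially
  many sets isolate all short cycles of all of them. Such a family is found uniformly by exhaustive
  search.\<close>

section \<open>Computable functions, decidable predicates and computable families of finite sets\<close>

abbreviation pfst :: "nat \<Rightarrow> nat" where "pfst z \<equiv> fst (prod_decode z)"

abbreviation psnd :: "nat \<Rightarrow> nat" where "psnd z \<equiv> snd (prod_decode z)"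

definition decidable :: "(nat \<Rightarrow> bool) \<Rightarrow> bool" where
  "decidable P \<longleftrightarrow> computable (\<lambda>x. of_bool (P x))"

definition computable_set :: "(nat \<Rightarrow> nat set) \<Rightarrow> bool" where
  "computable_set S \<longleftrightarrow> (\<forall>x. finite (S x)) \<and> computable (\<lambda>x. set_encode (S x))"

named_theorems computable_intros

lemma computable_pfst [computable_intros]: "computable f \<Longrightarrow> computable (\<lambda>x. pfst (f x))"
  using computable_comp[OF computable_fst] by simp

lemma computable_psnd [computable_intros]: "computable f \<Longrightarrow> computable (\<lambda>x. psnd (f x))"
  using computable_comp[OF computable_snd] by simp

lemma computable_Suc_comp [computable_intros]: "computable f \<Longrightarrow> computable (\<lambda>x. Suc (f x))"
  using computable_comp[OF computable_Suc] by simp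

lemmas [computable_intros] = computable_pair

lemma computable_ident [computable_intros]: "computable (\<lambda>x. x)"
proof -
  have "computable (\<lambda>x. prod_encode (pfst x, psnd x))"
    by (intro computable_pair computable_fst computable_snd)
  then show ?thesis by simp
qed

lemma computable_const [computable_intros]: "computable (\<lambda>_. c)"
  by (induction c) (auto intro: computable_zero computable_Suc_comp)

lemma computable_set_comp: "computable_set S \<Longrightarrow> computable f \<Longrightarrow> computable_set (\<lambda>x. S (f x))"
  unfolding computable_set_def using computable_comp by blast

lemma computable_set_comp2:
  assumes "computable_set (\<lambda>y. S (pfst y) (psnd y))" "computable f" "computable g"
  shows "computable_set (\<lambda>x. S (f x) (g x))"
  using computable_set_comp[OF assms(1) computable_pair[OF assms(2,3)]] by simp

text \<open>In the rules for binders the bound variable and its context are passed as one paired argument;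
  higher-order unification then reduces nested binders to chains of projections.\<close>

lemma computable_rec_nat [computable_intros]:
  assumes "computable b" "computable z"
    and s: "computable (\<lambda>y. s (pfst y) (pfst (psnd y)) (psnd (psnd y)))"
  shows "computable (\<lambda>x. rec_nat (z x) (s x) (b x))"
proof -
  have "computable (\<lambda>x. prod_encode (x, b x))"
    by (intro computable_intros assms)
  from computable_comp[OF computable_rec[OF assms(2) s] this] show ?thesis
    by simp
qed

lemma computable_add [computable_intros]:
  assumes "computable f" "computable g"
  shows "computable (\<lambda>x. f x + g x)"
proof -
  have "rec_nat c (\<lambda>_ r. Suc r) n = c + n" for c n
    by (induction n) auto
  moreover have "computable (\<lambda>x. rec_nat (f x) (\<lambda>_ r. Suc r) (g x))"
    by (intro computable_intros assms)
  ultimately show ?thesis by simp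
qed

lemma computable_sum_less [computable_intros]:
  assumes "computable b" and f: "computable (\<lambda>y. f (pfst y) (psnd y))"
  shows "computable (\<lambda>x. \<Sum>k<b x. f x k)"
proof -
  have "computable (\<lambda>y. prod_encode (pfst y, pfst (psnd y)))"
    by (intro computable_intros)
  from computable_comp[OF f this] have "computable (\<lambda>y. f (pfst y) (pfst (psnd y)))"
    by simp
  then have "computable (\<lambda>x. rec_nat 0 (\<lambda>k r. r + f x k) (b x))"
    by (intro computable_intros assms)
  moreover have "rec_nat 0 (\<lambda>k r. r + f x k) n = (\<Sum>k<n. f x k)" for x n
    by (induction n) auto
  ultimately show ?thesis by simp
qed

lemma computable_mult [computable_intros]:
  assumes "computable f" "computable g"
  shows "computable (\<lambda>x. f x * g x)"
proof -
  have "computable (\<lambda>x. \<Sum>k<g x. f x)"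
    by (intro computable_intros assms computable_comp[OF assms(1)])
  then show ?thesis by (simp add: mult.commute)
qed

lemma computable_power [computable_intros]:
  assumes "computable f" "computable g"
  shows "computable (\<lambda>x. f x ^ g x)"
proof -
  have "rec_nat 1 (\<lambda>_ r. r * c) n = c ^ n" for c n :: nat
    by (induction n) auto
  moreover have "computable (\<lambda>x. rec_nat 1 (\<lambda>_ r. r * f x) (g x))"
    by (intro computable_intros assms computable_comp[OF assms(1)])
  ultimately show ?thesis by simp
qed

lemma computable_diff [computable_intros]:
  assumes "computable f" "computable g"
  shows "computable (\<lambda>x. f x - g x)"
proof -
  have pred: "rec_nat 0 (\<lambda>k r. k) n = n - 1" for n
    by (cases n) auto
  have "rec_nat c (\<lambda>_ r. rec_nat 0 (\<lambda>k r. k) r) n = c - n" for c n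
    by (induction n) (auto simp: pred)
  moreover have "computable (\<lambda>x. rec_nat (f x) (\<lambda>_ r. rec_nat 0 (\<lambda>k r. k) r) (g x))"
    by (intro computable_intros assms)
  ultimately show ?thesis by simp
qed

lemma computable_of_bool [computable_intros]:
  "decidable P \<Longrightarrow> computable (\<lambda>x. of_bool (P x))"
  by (simp add: decidable_def)

lemma decidable_less [computable_intros]:
  assumes "computable f" "computable g"
  shows "decidable (\<lambda>x. f x < g x)"
proof -
  have "computable (\<lambda>x. 1 - (1 - (g x - f x)))"
    by (intro computable_intros assms)
  moreover have "1 - (1 - (b - a)) = of_bool (a < b)" for a b :: nat
    by auto
  ultimately show ?thesis by (simp only: decidable_def)
qed

lemma decidable_not [computable_intros]:
  assumes "decidable P"
  shows "decidable (\<lambda>x. \<not> P x)"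
proof -
  have "computable (\<lambda>x. 1 - of_bool (P x))"
    by (intro computable_intros assms)
  moreover have "1 - of_bool b = (of_bool (\<not> b) :: nat)" for b
    by auto
  ultimately show ?thesis by (simp only: decidable_def)
qed

lemma decidable_conj [computable_intros]:
  assumes "decidable P" "decidable Q"
  shows "decidable (\<lambda>x. P x \<and> Q x)"
proof -
  have "computable (\<lambda>x. of_bool (P x) * of_bool (Q x))"
    by (intro computable_intros assms)
  then show ?thesis by (simp only: decidable_def of_bool_conj)
qed

lemma decidable_imp [computable_intros]:
  assumes "decidable P" "decidable Q"
  shows "decidable (\<lambda>x. P x \<longrightarrow> Q x)"
proof -
  have "decidable (\<lambda>x. \<not> (P x \<and> \<not> Q x))"
    by (intro computable_intros assms)
  then show ?thesis by (simp only: not_imp[symmetric] not_not)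
qed

lemma decidable_disj [computable_intros]:
  assumes "decidable P" "decidable Q"
  shows "decidable (\<lambda>x. P x \<or> Q x)"
proof -
  have "decidable (\<lambda>x. \<not> P x \<longrightarrow> Q x)"
    by (intro computable_intros assms)
  then show ?thesis by (simp only: disj_imp)
qed

lemma decidable_le [computable_intros]:
  assumes "computable f" "computable g"
  shows "decidable (\<lambda>x. f x \<le> g x)"
  using decidable_not[OF decidable_less[OF assms(2,1)]] by (simp add: not_less)

lemma decidable_eq [computable_intros]:
  assumes "computable f" "computable g"
  shows "decidable (\<lambda>x. f x = g x)"
proof -
  have "decidable (\<lambda>x. f x \<le> g x \<and> g x \<le> f x)"
    by (intro computable_intros assms)
  then show ?thesis by (simp only: order_eq_iff[symmetric])
qed

lemma decidable_bex_less [computable_intros]: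
  assumes "computable b" "decidable (\<lambda>y. P (pfst y) (psnd y))"
  shows "decidable (\<lambda>x. \<exists>k<b x. P x k)"
proof -
  have "decidable (\<lambda>x. 0 < (\<Sum>k<b x. of_bool (P x k) :: nat))"
    by (intro computable_intros assms)
  moreover have "0 < (\<Sum>k<n. of_bool (Q k) :: nat) \<longleftrightarrow> (\<exists>k<n. Q k)" for n :: nat and Q
    by (induction n) (auto simp: less_Suc_eq)
  ultimately show ?thesis by (simp only:)
qed

lemma decidable_ball_less [computable_intros]:
  assumes "computable b" "decidable (\<lambda>y. P (pfst y) (psnd y))"
  shows "decidable (\<lambda>x. \<forall>k<b x. P x k)"
proof -
  have "decidable (\<lambda>x. \<not> (\<exists>k<b x. \<not> P x k))"
    by (intro computable_intros assms)
  then show ?thesis by simp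
qed

lemma computable_Least [computable_intros]:
  assumes P: "decidable (\<lambda>y. P (pfst y) (psnd y))" and ex: "\<And>x. \<exists>n. P x n"
  shows "computable (\<lambda>x. LEAST n. P x n)"
proof -
  have "computable (\<lambda>y. of_bool (\<not> P (pfst y) (psnd y)))"
    by (intro computable_intros P)
  from computable_min[OF this] ex show ?thesis by simp
qed

lemma computable_If [computable_intros]:
  assumes "decidable P" "computable f" "computable g"
  shows "computable (\<lambda>x. if P x then f x else g x)"
proof -
  have "computable (\<lambda>x. of_bool (P x) * f x + of_bool (\<not> P x) * g x)"
    by (intro computable_intros assms)
  moreover have "of_bool b * u + of_bool (\<not> b) * v = (if b then u else v)" for b and u v :: nat
    by auto
  ultimately show ?thesis by (simp only:)
qed

lemma div_eq_Least:
  fixes a b :: nat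
  shows "a div b = (LEAST q. b = 0 \<or> a < Suc q * b)"
proof (cases "b = 0")
  case True
  then show ?thesis by (intro Least_equality[symmetric]) auto
next
  case False
  then have "a < Suc q * b \<longleftrightarrow> a div b \<le> q" for q
    by (simp only: less_Suc_eq_le[symmetric] div_less_iff_less_mult neq0_conv)
  with False show ?thesis by (intro Least_equality[symmetric]) auto
qed

lemma computable_div [computable_intros]:
  assumes "computable f" "computable g"
  shows "computable (\<lambda>x. f x div g x)"
proof -
  have "\<exists>q. b = 0 \<or> a < Suc q * b" for a b :: nat
    by (intro exI[of _ a]) (cases b; simp)
  then have "computable (\<lambda>x. LEAST q. g x = 0 \<or> f x < Suc q * g x)"
    by (intro computable_intros assms[THEN computable_comp])
  then show ?thesis by (simp only: div_eq_Least)
qed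

lemma computable_mod [computable_intros]:
  assumes "computable f" "computable g"
  shows "computable (\<lambda>x. f x mod g x)"
proof -
  have "computable (\<lambda>x. f x - f x div g x * g x)"
    by (intro computable_intros assms)
  then show ?thesis by (simp add: minus_div_mult_eq_mod)
qed

lemma computable_set_encode [computable_intros]:
  "computable_set S \<Longrightarrow> computable (\<lambda>x. set_encode (S x))"
  by (simp add: computable_set_def)

lemma computable_set_set_decode [computable_intros]:
  "computable f \<Longrightarrow> computable_set (\<lambda>x. set_decode (f x))"
  by (simp add: computable_set_def)

lemma computable_set_finite: "computable_set S \<Longrightarrow> finite (S x)"
  by (simp add: computable_set_def)

lemma decidable_even [computable_intros]: "computable f \<Longrightarrow> decidable (\<lambda>x. even (f x))"
  unfolding even_iff_mod_2_eq_zero by (intro computable_intros)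

lemma decidable_mem [computable_intros]:
  assumes "computable f" "computable_set S"
  shows "decidable (\<lambda>x. f x \<in> S x)"
proof -
  have "decidable (\<lambda>x. odd (set_encode (S x) div 2 ^ f x))"
    by (intro computable_intros assms)
  moreover have "n \<in> S x \<longleftrightarrow> odd (set_encode (S x) div 2 ^ n)" for n x
    using set_encode_inverse[OF computable_set_finite[OF assms(2)]] by (auto simp: set_decode_def)
  ultimately show ?thesis by simp
qed

lemma less_set_encode:
  assumes "finite A" "n \<in> A"
  shows "n < set_encode A"
proof -
  have "n < 2 ^ n" by simp
  also have "\<dots> \<le> set_encode A"
    unfolding set_encode_def using assms by (intro member_le_sum) auto
  finally show ?thesis .
qed

lemma computable_set_bounded:
  assumes "computable b" "decidable (\<lambda>y. psnd y \<in> S (pfst y))"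
    and bounded: "\<And>x. S x \<subseteq> {..<b x}"
  shows "computable_set S"
proof -
  have "computable (\<lambda>x. \<Sum>k<b x. of_bool (k \<in> S x) * 2 ^ k)"
    by (intro computable_intros assms)
  moreover have "(\<Sum>k<b x. of_bool (k \<in> S x) * 2 ^ k) = set_encode (S x)" for x
    unfolding set_encode_def using bounded[of x] by (intro sum.mono_neutral_cong_right) auto
  moreover have "finite (S x)" for x
    using bounded finite_subset by blast
  ultimately show ?thesis
    by (simp add: computable_set_def)
qed

lemma computable_set_lessThan [computable_intros]:
  assumes "computable f"
  shows "computable_set (\<lambda>x. {..<f x})"
proof (rule computable_set_bounded[OF assms])
  show "decidable (\<lambda>y. psnd y \<in> {..<f (pfst y)})"
    unfolding lessThan_iff by (intro computable_intros assms[THEN computable_comp])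
qed simp

lemma computable_set_filter [computable_intros]:
  assumes "computable_set S" and P: "decidable (\<lambda>y. P (pfst y) (psnd y))"
  shows "computable_set (\<lambda>x. {k \<in> S x. P x k})"
proof (rule computable_set_bounded)
  show "computable (\<lambda>x. set_encode (S x))"
    by (intro computable_intros assms)
  show "decidable (\<lambda>y. psnd y \<in> {k \<in> S (pfst y). P (pfst y) k})"
    unfolding mem_Collect_eq by (intro computable_intros P computable_set_comp[OF assms(1)])
  show "{k \<in> S x. P x k} \<subseteq> {..<set_encode (S x)}" for x
    using less_set_encode[OF computable_set_finite[OF assms(1)]] by blast
qed

lemma computable_set_empty [computable_intros]: "computable_set (\<lambda>_. {})"
  using computable_set_set_decode[OF computable_const[of 0]] by simp

lemma computable_set_insert [computable_intros]:
  assumes "computable f" "computable_set S"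
  shows "computable_set (\<lambda>x. insert (f x) (S x))"
proof (rule computable_set_bounded)
  show "computable (\<lambda>x. Suc (f x + set_encode (S x)))"
    by (intro computable_intros assms)
  show "decidable (\<lambda>y. psnd y \<in> insert (f (pfst y)) (S (pfst y)))"
    unfolding insert_iff
    by (intro computable_intros computable_comp[OF assms(1)] computable_set_comp[OF assms(2)])
  show "insert (f x) (S x) \<subseteq> {..<Suc (f x + set_encode (S x))}" for x
    using less_set_encode[OF computable_set_finite[OF assms(2)], of _ x]
    by (auto intro: less_SucI trans_less_add2)
qed

lemma computable_set_Int [computable_intros]:
  assumes "computable_set S" "computable_set T"
  shows "computable_set (\<lambda>x. S x \<inter> T x)"
proof -
  have "computable_set (\<lambda>x. {k \<in> S x. k \<in> T x})"
    by (intro computable_intros assms[THEN computable_set_comp])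
  then show ?thesis by (simp only: Int_def)
qed

lemma computable_sum [computable_intros]:
  assumes "computable_set S" and f: "computable (\<lambda>y. f (pfst y) (psnd y))"
  shows "computable (\<lambda>x. \<Sum>k\<in>S x. f x k)"
proof -
  have "computable (\<lambda>x. \<Sum>k<set_encode (S x). of_bool (k \<in> S x) * f x k)"
    by (intro computable_intros f assms(1)[THEN computable_set_comp])
  moreover have "(\<Sum>k<set_encode (S x). of_bool (k \<in> S x) * f x k) = (\<Sum>k\<in>S x. f x k)" for x
    using less_set_encode[OF computable_set_finite[OF assms(1)], of _ x]
    by (intro sum.mono_neutral_cong_right) auto
  ultimately show ?thesis by simp
qed

lemma computable_card [computable_intros]:
  assumes "computable_set S"
  shows "computable (\<lambda>x. card (S x))"
  unfolding card_eq_sum by (intro computable_intros assms)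

lemma decidable_ball [computable_intros]:
  assumes "computable_set S" and P: "decidable (\<lambda>y. P (pfst y) (psnd y))"
  shows "decidable (\<lambda>x. \<forall>k\<in>S x. P x k)"
proof -
  have "decidable (\<lambda>x. \<forall>k<set_encode (S x). k \<in> S x \<longrightarrow> P x k)"
    by (intro computable_intros P assms(1)[THEN computable_set_comp])
  moreover have "(\<forall>k<set_encode (S x). k \<in> S x \<longrightarrow> P x k) \<longleftrightarrow> (\<forall>k\<in>S x. P x k)" for x
    using less_set_encode[OF computable_set_finite[OF assms(1)]] by blast
  ultimately show ?thesis by simp
qed

lemma decidable_bex [computable_intros]:
  assumes "computable_set S" "decidable (\<lambda>y. P (pfst y) (psnd y))"
  shows "decidable (\<lambda>x. \<exists>k\<in>S x. P x k)"
proof -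
  have "decidable (\<lambda>x. \<not> (\<forall>k\<in>S x. \<not> P x k))"
    by (intro computable_intros assms)
  then show ?thesis by simp
qed

lemma decidable_subset [computable_intros]:
  assumes "computable_set S" "computable_set T"
  shows "decidable (\<lambda>x. S x \<subseteq> T x)"
  unfolding subset_eq by (intro computable_intros assms[THEN computable_set_comp])

lemma decidable_eq_empty [computable_intros]:
  assumes "computable_set S"
  shows "decidable (\<lambda>x. S x = {})"
proof -
  have "decidable (\<lambda>x. set_encode (S x) = 0)"
    by (intro computable_intros assms)
  moreover have "set_encode (S x) = 0 \<longleftrightarrow> S x = {}" for x
    using set_encode_eq[OF computable_set_finite[OF assms], of "{}" x] by simp
  ultimately show ?thesis by simp
qed

lemma decidable_all_subset [computable_intros]:
  assumes "computable_set S" and P: "decidable (\<lambda>y. P (pfst y) (set_decode (psnd y)))"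
  shows "decidable (\<lambda>x. \<forall>T\<subseteq>S x. P x T)"
proof -
  have "decidable (\<lambda>x. \<forall>c\<le>set_encode (S x). set_decode c \<subseteq> S x \<longrightarrow> P x (set_decode c))"
    unfolding less_Suc_eq_le[symmetric]
    by (intro computable_intros P assms(1)[THEN computable_set_comp])
  moreover have "(\<forall>c\<le>set_encode (S x). set_decode c \<subseteq> S x \<longrightarrow> P x (set_decode c))
      \<longleftrightarrow> (\<forall>T\<subseteq>S x. P x T)" (is "?codes \<longleftrightarrow> ?sets") for x
  proof
    assume codes: ?codes
    show ?sets
    proof (intro allI impI)
      fix T assume "T \<subseteq> S x"
      moreover have "finite (S x)" using assms(1) by (rule computable_set_finite)
      ultimately have "set_decode (set_encode T) = T" "set_decode (set_encode (S x)) = S x"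
        by (auto dest: finite_subset)
      with codes \<open>T \<subseteq> S x\<close> show "P x T"
        by (metis subset_decode_imp_le)
    qed
  qed blast
  ultimately show ?thesis by simp
qed

section \<open>Codes of lists\<close>

definition list_code_drop :: "nat \<Rightarrow> nat \<Rightarrow> nat" where
  "list_code_drop n c = rec_nat c (\<lambda>_ r. psnd (r - 1)) n"

definition list_code_nth :: "nat \<Rightarrow> nat \<Rightarrow> nat" where
  "list_code_nth c n = pfst (list_code_drop n c - 1)"

definition list_code_length :: "nat \<Rightarrow> nat" where
  "list_code_length c = (LEAST n. list_code_drop n c = 0)"

lemma prod_decode_0: "prod_decode 0 = (0, 0)"
  using prod_encode_inverse[of "(0, 0)"] by (simp add: prod_encode_def)

lemma list_code_drop: "list_code_drop n (list_encode xs) = list_encode (drop n xs)"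
proof (induction n)
  case (Suc n)
  have "list_code_drop (Suc n) (list_encode xs) = psnd (list_encode (drop n xs) - 1)"
    using Suc by (simp add: list_code_drop_def)
  also have "\<dots> = list_encode (drop (Suc n) xs)"
  proof (cases "n < length xs")
    case True
    then show ?thesis by (simp add: Cons_nth_drop_Suc[symmetric])
  qed (simp add: prod_decode_0)
  finally show ?case .
qed (simp add: list_code_drop_def)

lemma list_code_nth:
  "list_code_nth (list_encode xs) n = (if n < length xs then xs ! n else 0)"
  by (simp add: list_code_nth_def list_code_drop Cons_nth_drop_Suc[symmetric] prod_decode_0)

lemma list_code_length: "list_code_length (list_encode xs) = length xs"
proof -
  have "list_code_drop n (list_encode xs) = 0 \<longleftrightarrow> length xs \<le> n" for n
    using list_encode_eq[of "drop n xs" "[]"] by (simp add: list_code_drop)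
  then show ?thesis
    unfolding list_code_length_def by (intro Least_equality) auto
qed

lemma computable_list_code_drop [computable_intros]:
  "computable f \<Longrightarrow> computable g \<Longrightarrow> computable (\<lambda>x. list_code_drop (f x) (g x))"
  unfolding list_code_drop_def by (intro computable_intros)

lemma computable_list_code_nth [computable_intros]:
  "computable f \<Longrightarrow> computable g \<Longrightarrow> computable (\<lambda>x. list_code_nth (f x) (g x))"
  unfolding list_code_nth_def by (intro computable_intros)

lemma computable_list_code_length [computable_intros]:
  assumes "computable f"
  shows "computable (\<lambda>x. list_code_length (f x))"
proof -
  have "list_code_drop (length (list_decode c)) c = 0" for c
    using list_code_drop[of _ "list_decode c"] by simp
  then have "\<exists>n. list_code_drop n c = 0" for c
    by blast
  then show ?thesis
    unfolding list_code_length_def by (intro computable_intros assms[THEN computable_comp])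
qed

lemma computable_list_encode_map [computable_intros]:
  assumes "computable b" and f: "computable (\<lambda>y. f (pfst y) (psnd y))"
  shows "computable (\<lambda>x. list_encode (map (f x) [0..<b x]))"
proof -
  have f_comp: "computable (\<lambda>y. f (u y) (v y))" if "computable u" "computable v" for u v
    using computable_comp[OF f computable_pair[OF that]] by simp
  have "computable (\<lambda>x. rec_nat 0 (\<lambda>k r. Suc (prod_encode (f x (b x - Suc k), r))) (b x))"
    by (intro computable_intros f_comp assms(1)[THEN computable_comp])
  moreover have "rec_nat 0 (\<lambda>k r. Suc (prod_encode (f x (n - Suc k), r))) i
      = list_encode (map (f x) [n - i..<n])" if "i \<le> n" for x n i
    using that
  proof (induction i)
    case (Suc i)
    then have "[n - Suc i..<n] = (n - Suc i) # [n - i..<n]"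
      by (simp add: upt_conv_Cons Suc_diff_Suc)
    then show ?case using Suc by simp
  qed simp
  ultimately show ?thesis by simp
qed

section \<open>The cycle space of a graph\<close>

definition graph_on :: "'v set \<Rightarrow> 'e set \<Rightarrow> ('e \<Rightarrow> 'v set) \<Rightarrow> bool" where
  "graph_on V E \<epsilon> \<longleftrightarrow> (\<forall>e\<in>E. \<exists>u\<in>V. \<exists>w\<in>V. \<epsilon> e = {u, w})"

text \<open>Only the parities of vertex degrees matter, so a loop, which adds 2 to the degree, is left out of
  the star of its vertex.\<close>

definition star :: "('e \<Rightarrow> 'v set) \<Rightarrow> 'v \<Rightarrow> 'e set" where
  "star \<epsilon> v = {e. v \<in> \<epsilon> e \<and> \<epsilon> e \<noteq> {v}}"

definition even_set :: "('e \<Rightarrow> 'v set) \<Rightarrow> 'e set \<Rightarrow> bool" where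
  "even_set \<epsilon> T \<longleftrightarrow> finite T \<and> (\<forall>v. even (card (T \<inter> star \<epsilon> v)))"

definition even_subsets :: "('e \<Rightarrow> 'v set) \<Rightarrow> 'e set \<Rightarrow> 'e set set" where
  "even_subsets \<epsilon> E = {T. T \<subseteq> E \<and> T \<noteq> {} \<and> even_set \<epsilon> T}"

definition forest :: "('e \<Rightarrow> 'v set) \<Rightarrow> 'e set \<Rightarrow> bool" where
  "forest \<epsilon> E \<longleftrightarrow> even_subsets \<epsilon> E = {}"

definition girth_ge :: "('e \<Rightarrow> 'v set) \<Rightarrow> 'e set \<Rightarrow> nat \<Rightarrow> bool" where
  "girth_ge \<epsilon> E g \<longleftrightarrow> (\<forall>T\<in>even_subsets \<epsilon> E. g \<le> card T)"

lemma graph_on_subset: "graph_on V E \<epsilon> \<Longrightarrow> F \<subseteq> E \<Longrightarrow> graph_on V F \<epsilon>"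
  by (auto simp: graph_on_def)

lemma graph_on_ends_subset: "graph_on V E \<epsilon> \<Longrightarrow> e \<in> E \<Longrightarrow> \<epsilon> e \<subseteq> V"
  by (fastforce simp: graph_on_def)

lemma even_subsetsI: "T \<subseteq> E \<Longrightarrow> T \<noteq> {} \<Longrightarrow> even_set \<epsilon> T \<Longrightarrow> T \<in> even_subsets \<epsilon> E"
  by (simp add: even_subsets_def)

lemma even_subsetsD:
  assumes "T \<in> even_subsets \<epsilon> E"
  shows "T \<subseteq> E" "T \<noteq> {}" "even_set \<epsilon> T" "finite T"
  using assms by (auto simp: even_subsets_def even_set_def)

lemma even_subsets_mono: "E \<subseteq> F \<Longrightarrow> even_subsets \<epsilon> E \<subseteq> even_subsets \<epsilon> F"
  by (auto simp: even_subsets_def)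

lemma even_set_cong:
  assumes "\<And>e. e \<in> T \<Longrightarrow> \<epsilon> e = \<epsilon>' e"
  shows "even_set \<epsilon> T \<longleftrightarrow> even_set \<epsilon>' T"
proof -
  have "T \<inter> star \<epsilon> v = T \<inter> star \<epsilon>' v" for v
    using assms by (auto simp: star_def)
  then show ?thesis by (simp add: even_set_def)
qed

lemma even_subsets_cong:
  assumes "\<And>e. e \<in> E \<Longrightarrow> \<epsilon> e = \<epsilon>' e"
  shows "even_subsets \<epsilon> E = even_subsets \<epsilon>' E"
proof -
  have "even_set \<epsilon> T \<longleftrightarrow> even_set \<epsilon>' T" if "T \<subseteq> E" for T
    using assms that by (intro even_set_cong) auto
  then show ?thesis by (auto simp: even_subsets_def)
qed

lemma even_set_image:
  assumes "inj_on \<phi> V" and sub: "\<And>e. e \<in> T \<Longrightarrow> \<epsilon> e \<subseteq> V"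
  shows "even_set (\<lambda>e. \<phi> ` \<epsilon> e) T \<longleftrightarrow> even_set \<epsilon> T"
proof -
  let ?image = "\<lambda>e. \<phi> ` \<epsilon> e"
  have "T \<inter> star ?image (\<phi> v) = T \<inter> star \<epsilon> v" if "v \<in> V" for v
  proof -
    have "\<phi> v \<in> \<phi> ` \<epsilon> e \<longleftrightarrow> v \<in> \<epsilon> e" "\<phi> ` \<epsilon> e = {\<phi> v} \<longleftrightarrow> \<epsilon> e = {v}" if "e \<in> T" for e
      using inj_on_image_mem_iff[OF assms(1) \<open>v \<in> V\<close> sub[OF that]]
        inj_on_image_eq_iff[OF assms(1) sub[OF that], of "{v}"] \<open>v \<in> V\<close> by simp_all
    then show ?thesis by (auto simp: star_def)
  qed
  moreover have "T \<inter> star ?image v = {}" if "v \<notin> \<phi> ` V" for v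
    using sub that by (auto simp: star_def)
  then have "(\<forall>v. even (card (T \<inter> star ?image v))) \<longleftrightarrow> (\<forall>v\<in>\<phi> ` V. even (card (T \<inter> star ?image v)))"
    by (metis card.empty even_zero)
  moreover have "T \<inter> star \<epsilon> v = {}" if "v \<notin> V" for v
    using sub that by (auto simp: star_def)
  then have "(\<forall>v. even (card (T \<inter> star \<epsilon> v))) \<longleftrightarrow> (\<forall>v\<in>V. even (card (T \<inter> star \<epsilon> v)))"
    by (metis card.empty even_zero)
  ultimately show ?thesis
    by (simp add: even_set_def)
qed

lemma even_card_sym_diff:
  assumes "finite A" "finite B"
  shows "even (card (sym_diff A B)) \<longleftrightarrow> even (card A + card B)"
proof -
  have "card (sym_diff A B) = card (A - B) + card (B - A)"
    using assms by (intro card_Un_disjoint) auto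
  then show ?thesis
    using card_Int_Diff[OF assms(1), of B] card_Int_Diff[OF assms(2), of A]
    by (auto simp: Int_commute)
qed

lemma even_card_sym_diff_Int:
  assumes "finite A" "finite B"
  shows "even (card (sym_diff A B \<inter> S)) \<longleftrightarrow> even (card (A \<inter> S) + card (B \<inter> S))"
proof -
  have "sym_diff A B \<inter> S = sym_diff (A \<inter> S) (B \<inter> S)"
    by auto
  then show ?thesis
    using assms by (simp add: even_card_sym_diff)
qed

lemma even_set_sym_diff: "even_set \<epsilon> A \<Longrightarrow> even_set \<epsilon> B \<Longrightarrow> even_set \<epsilon> (sym_diff A B)"
  by (auto simp: even_set_def even_card_sym_diff_Int)

text \<open>Gaussian elimination over the two-element field: adding a suitable \<open>C\<close> cancels the largest element
  of \<open>D\<close> outside \<open>insert e B\<close>.\<close>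

lemma even_set_cancel_greatest:
  fixes B :: "'e :: linorder set"
  assumes spanned: "\<And>f. f < e \<Longrightarrow> f \<notin> B \<Longrightarrow> \<exists>C. even_set \<epsilon> C \<and> f \<in> C \<and> C \<subseteq> {..f}"
    and D: "even_set \<epsilon> D" "e \<in> D" "D \<subseteq> insert e B \<union> {..<n}" "\<not> D \<subseteq> insert e B" and "n \<le> e"
  obtains f D' where "f < n" "even_set \<epsilon> D'" "e \<in> D'" "D' \<subseteq> insert e B \<union> {..<f}"
proof -
  define f where "f = Max (D - insert e B)"
  have fin: "finite (D - insert e B)"
    using D(1) by (simp add: even_set_def)
  then have f: "f \<in> D - insert e B"
    using D(4) unfolding f_def by (intro Max_in) auto
  have max: "d \<le> f" if "d \<in> D - insert e B" for d
    using fin that unfolding f_def by (rule Max_ge)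
  have "f < n" using f D(3) by auto
  then have "f < e" using \<open>n \<le> e\<close> by simp
  with f obtain C where C: "even_set \<epsilon> C" "f \<in> C" "C \<subseteq> {..f}"
    using spanned by blast
  have "even_set \<epsilon> (sym_diff D C)" using D(1) C(1) by (rule even_set_sym_diff)
  moreover have "e \<in> sym_diff D C" using C(3) \<open>f < e\<close> D(2) by auto
  moreover have "d < f" if "d \<in> sym_diff D C" "d \<notin> insert e B" for d
    using that C(2,3) f max[of d] by (cases "d = f") (auto simp: less_le)
  then have "sym_diff D C \<subseteq> insert e B \<union> {..<f}" by blast
  ultimately show ?thesis by (rule that[OF \<open>f < n\<close>])
qed

lemma even_set_eliminate:
  fixes B :: "'e :: wellorder set"
  assumes spanned: "\<And>f. f \<le> e \<Longrightarrow> f \<notin> B \<Longrightarrow> \<exists>C. even_set \<epsilon> C \<and> f \<in> C \<and> C \<subseteq> {..f}"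
    and "e \<notin> B"
  shows "\<exists>D. even_set \<epsilon> D \<and> e \<in> D \<and> D \<subseteq> insert e B"
proof -
  have eliminate: "\<exists>D'. even_set \<epsilon> D' \<and> e \<in> D' \<and> D' \<subseteq> insert e B"
    if "even_set \<epsilon> D" "e \<in> D" "D \<subseteq> insert e B \<union> {..<n}" "n \<le> e" for D n
    using that
  proof (induction n arbitrary: D rule: less_induct)
    case (less n)
    show ?case
    proof (cases "D \<subseteq> insert e B")
      case True
      with less.prems(1,2) show ?thesis by blast
    next
      case False
      obtain f D' where "f < n" "even_set \<epsilon> D'" "e \<in> D'" "D' \<subseteq> insert e B \<union> {..<f}"
        using even_set_cancel_greatest[OF _ less.prems(1-3) False less.prems(4)] spanned less_imp_le
        by metis
      with less.IH less.prems(4) show ?thesis by simp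
    qed
  qed
  obtain C where C: "even_set \<epsilon> C" "e \<in> C" "C \<subseteq> {..e}"
    using spanned[OF order_refl assms(2)] by blast
  then have "C \<subseteq> insert e B \<union> {..<e}"
    by (auto simp: le_less)
  with C show ?thesis by (intro eliminate[OF _ _ _ order_refl])
qed

section \<open>Trails\<close>

definition joins :: "('e \<Rightarrow> 'v set) \<Rightarrow> 'e set \<Rightarrow> 'v \<Rightarrow> 'v \<Rightarrow> bool" where
  "joins \<epsilon> P u w \<longleftrightarrow> finite P \<and> (\<forall>v. odd (card (P \<inter> star \<epsilon> v)) \<longleftrightarrow> (v = u) \<noteq> (v = w))"

definition trail :: "('e \<Rightarrow> 'v set) \<Rightarrow> (nat \<Rightarrow> 'v) \<Rightarrow> 'e list \<Rightarrow> bool" where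
  "trail \<epsilon> p es \<longleftrightarrow> distinct es \<and> (\<forall>i<length es. \<epsilon> (es ! i) = {p i, p (Suc i)})"

definition closed_trail :: "('e \<Rightarrow> 'v set) \<Rightarrow> (nat \<Rightarrow> 'v) \<Rightarrow> 'e list \<Rightarrow> bool" where
  "closed_trail \<epsilon> p es \<longleftrightarrow> es \<noteq> [] \<and> trail \<epsilon> p es \<and> p (length es) = p 0"

lemma even_set_iff_joins: "even_set \<epsilon> T \<longleftrightarrow> joins \<epsilon> T u u"
  by (simp add: even_set_def joins_def)

lemma joins_sym_diff: "joins \<epsilon> A u w \<Longrightarrow> joins \<epsilon> B u w \<Longrightarrow> even_set \<epsilon> (sym_diff A B)"
  by (auto simp: joins_def even_set_def even_card_sym_diff_Int)

lemma joins_insert: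
  assumes "joins \<epsilon> P u w" "e \<notin> P" "\<epsilon> e = {w, w'}"
  shows "joins \<epsilon> (insert e P) u w'"
proof -
  have "e \<in> star \<epsilon> v \<longleftrightarrow> (v = w) \<noteq> (v = w')" for v
    using assms(3) by (auto simp: star_def)
  then show ?thesis
    using assms(1,2) by (auto simp: joins_def Int_insert_left)
qed

lemma trail_take: "trail \<epsilon> p es \<Longrightarrow> trail \<epsilon> p (take k es)"
  by (simp add: trail_def)

lemma trail_drop: "trail \<epsilon> p es \<Longrightarrow> trail \<epsilon> (\<lambda>i. p (i + k)) (drop k es)"
  by (auto simp: trail_def add.commute)

lemma trail_snoc:
  assumes "trail \<epsilon> p es" "f \<notin> set es" "\<epsilon> f = {p (length es), w}"
  shows "trail \<epsilon> (p(Suc (length es) := w)) (es @ [f])"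
  using assms by (auto simp: trail_def nth_append less_Suc_eq)

lemma trail_joins: "trail \<epsilon> p es \<Longrightarrow> joins \<epsilon> (set es) (p 0) (p (length es))"
proof (induction es rule: rev_induct)
  case Nil
  then show ?case by (simp add: joins_def)
next
  case (snoc e es)
  have "trail \<epsilon> p es"
    using trail_take[OF snoc.prems, of "length es"] by simp
  moreover have "e \<notin> set es" "\<epsilon> e = {p (length es), p (Suc (length es))}"
    using snoc.prems by (auto simp: trail_def nth_append dest: spec[of _ "length es"])
  ultimately show ?case
    using joins_insert snoc.IH by fastforce
qed

lemma closed_trail_even_set: "closed_trail \<epsilon> p es \<Longrightarrow> even_set \<epsilon> (set es)"
  using trail_joins[of \<epsilon> p es] even_set_iff_joins[of \<epsilon> "set es" "p 0"]
  by (simp add: closed_trail_def)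

lemma trail_vertex_mem:
  assumes "trail \<epsilon> p es" "graph_on V (set es) \<epsilon>" "es \<noteq> []" "i \<le> length es"
  shows "p i \<in> V"
proof -
  obtain j where j: "j < length es" "i = j \<or> i = Suc j"
    using assms(3,4) by (cases "i = length es") (auto intro: that[of "length es - 1"] that[of i])
  then have "p i \<in> \<epsilon> (es ! j)"
    using assms(1) by (auto simp: trail_def)
  with graph_on_ends_subset[OF assms(2) nth_mem[OF j(1)]] show ?thesis by blast
qed

lemma open_trail_extend:
  assumes "even_set \<epsilon> T" "graph_on V T \<epsilon>" "trail \<epsilon> p es" "set es \<subseteq> T" "p (length es) \<noteq> p 0"
  obtains f w where "f \<in> T - set es" "\<epsilon> f = {p (length es), w}"
proof -
  let ?S = "star \<epsilon> (p (length es))"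
  have "odd (card (set es \<inter> ?S))"
    using trail_joins[OF assms(3)] assms(5) by (simp add: joins_def)
  moreover have "even (card (T \<inter> ?S))"
    using assms(1) by (simp add: even_set_def)
  ultimately have "set es \<inter> ?S \<noteq> T \<inter> ?S" by metis
  with assms(4) obtain f where "f \<in> T - set es" "p (length es) \<in> \<epsilon> f"
    by (auto simp: star_def)
  moreover from this obtain w where "\<epsilon> f = {p (length es), w}"
    using assms(2) unfolding graph_on_def by (metis DiffD1 insert_commute insert_iff singletonD)
  ultimately show ?thesis using that by blast
qed

lemma even_subset_contains_closed_trail:
  assumes "T \<in> even_subsets \<epsilon> E" "graph_on V E \<epsilon>"
  obtains p es where "closed_trail \<epsilon> p es" "set es \<subseteq> T"
proof -
  note T = even_subsetsD[OF assms(1)]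
  have graph: "graph_on V T \<epsilon>" using assms(2) T(1) by (rule graph_on_subset)
  define trail_in where "trail_in = (\<lambda>(p, es). trail \<epsilon> p es \<and> set es \<subseteq> T \<and> es \<noteq> [])"
  obtain e where "e \<in> T" using T(2) by blast
  with graph obtain u w where "\<epsilon> e = {u, w}" unfolding graph_on_def by blast
  with \<open>e \<in> T\<close> have "trail_in (\<lambda>i. if i = 0 then u else w, [e])"
    by (simp add: trail_in_def trail_def)
  moreover have "length (snd y) < Suc (card T)" if "trail_in y" for y
    using that card_mono[OF T(4), of "set (snd y)"]
    by (auto simp: trail_in_def trail_def distinct_card less_Suc_eq_le)
  ultimately obtain y where "trail_in y" "\<And>z. trail_in z \<Longrightarrow> length (snd z) \<le> length (snd y)"
    using ex_has_greatest_nat[of trail_in _ "\<lambda>y. length (snd y)"] by blast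
  then obtain p es where "trail_in (p, es)"
    and longest: "\<And>q fs. trail_in (q, fs) \<Longrightarrow> length fs \<le> length es"
    by (cases y) fastforce
  then have tr: "trail \<epsilon> p es" "set es \<subseteq> T" "es \<noteq> []" by (auto simp: trail_in_def)
  have "p (length es) = p 0"
  proof (rule ccontr)
    assume "p (length es) \<noteq> p 0"
    then obtain f w where "f \<in> T - set es" "\<epsilon> f = {p (length es), w}"
      using open_trail_extend[OF T(3) graph tr(1,2)] by blast
    with tr have "trail_in (p(Suc (length es) := w), es @ [f])"
      by (auto simp: trail_in_def intro!: trail_snoc)
    from longest[OF this] show False by simp
  qed
  with tr that show ?thesis by (auto simp: closed_trail_def)
qed

lemma contains_cycle_mono: "contains_cycle G S \<Longrightarrow> S \<subseteq> S' \<Longrightarrow> contains_cycle G S'"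
  unfolding contains_cycle_def by blast

lemma wf_mgraph_graph_on: "wf_mgraph G \<Longrightarrow> graph_on (verts G) (edges G) (ends G)"
  unfolding graph_on_def
proof
  fix e assume "wf_mgraph G" "e \<in> edges G"
  then have "ends G e \<subseteq> verts G" "card (ends G e) \<in> {1, 2}"
    by (auto simp: wf_mgraph_def)
  then show "\<exists>u\<in>verts G. \<exists>w\<in>verts G. ends G e = {u, w}"
    by (auto simp: card_1_singleton_iff card_2_iff)
qed

lemma simple_closed_trail_is_cycle:
  assumes "wf_mgraph G" "closed_trail (ends G) p es" "set es \<subseteq> edges G"
    and "inj_on p {..<length es}"
  shows "is_cycle G (map p [0..<length es]) es"
proof -
  note tr = assms(2)[unfolded closed_trail_def]
  have "graph_on (verts G) (set es) (ends G)"
    using wf_mgraph_graph_on[OF assms(1)] assms(3) by (rule graph_on_subset)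
  then have "p i \<in> verts G" if "i < length es" for i
    using trail_vertex_mem[of "ends G" p es "verts G" i] tr that by simp
  moreover have "p (Suc i) = p (Suc i mod length es)" if "i < length es" for i
    using that tr by (cases "Suc i = length es") auto
  ultimately show ?thesis
    using tr assms(3,4) by (auto simp: is_cycle_def trail_def distinct_map atLeast0LessThan)
qed

lemma closed_trail_contains_cycle:
  assumes "wf_mgraph G" "closed_trail (ends G) p es" "set es \<subseteq> edges G"
  shows "contains_cycle G (set es)"
  using assms(2,3)
proof (induction es arbitrary: p rule: measure_induct_rule[of length])
  case (less es)
  note tr = less.prems(1)[unfolded closed_trail_def]
  show ?case
  proof (cases "inj_on p {..<length es}")
    case True
    then show ?thesis
      using simple_closed_trail_is_cycle[OF assms(1) less.prems] by (auto simp: contains_cycle_def)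
  next
    case False
    then obtain i j where ij: "i < j" "j < length es" "p i = p j"
      by (metis inj_onI lessThan_iff linorder_neqE_nat)
    let ?fs = "take (j - i) (drop i es)"
    have sub: "set ?fs \<subseteq> set es"
      by (meson order_trans set_drop_subset set_take_subset)
    have "trail (ends G) (\<lambda>k. p (k + i)) ?fs"
      using tr by (intro trail_take trail_drop) simp
    then have "closed_trail (ends G) (\<lambda>k. p (k + i)) ?fs"
      using ij by (auto simp: closed_trail_def)
    moreover have "length ?fs < length es" using ij by simp
    ultimately have "contains_cycle G (set ?fs)"
      using less.IH less.prems(2) sub by (meson order_trans)
    then show ?thesis using sub by (rule contains_cycle_mono)
  qed
qed

lemma is_cycle_even_set:
  assumes "is_cycle G vs es"
  shows "even_set (ends G) (set es)"
proof -
  have "closed_trail (ends G) (\<lambda>i. vs ! (i mod length es)) es"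
    using assms by (auto simp: closed_trail_def trail_def is_cycle_def)
  then show ?thesis by (rule closed_trail_even_set)
qed

lemma contains_cycle_iff_not_forest:
  assumes "wf_mgraph G" "S \<subseteq> edges G"
  shows "contains_cycle G S \<longleftrightarrow> \<not> forest (ends G) S"
proof
  assume "contains_cycle G S"
  then obtain vs es where "is_cycle G vs es" "set es \<subseteq> S"
    by (auto simp: contains_cycle_def)
  moreover from this have "set es \<in> even_subsets (ends G) S"
    using is_cycle_even_set by (intro even_subsetsI) (auto simp: is_cycle_def)
  ultimately show "\<not> forest (ends G) S"
    by (auto simp: forest_def)
next
  assume "\<not> forest (ends G) S"
  then obtain T where T: "T \<in> even_subsets (ends G) S" by (auto simp: forest_def)
  moreover have "graph_on (verts G) S (ends G)"
    using wf_mgraph_graph_on[OF assms(1)] assms(2) by (rule graph_on_subset)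
  ultimately obtain p es where "closed_trail (ends G) p es" "set es \<subseteq> T"
    by (rule even_subset_contains_closed_trail)
  with T assms show "contains_cycle G S"
    by (meson closed_trail_contains_cycle contains_cycle_mono even_subsetsD(1) subset_trans)
qed

lemma card_Union_ends_le:
  assumes "finite E" "graph_on V E \<epsilon>"
  shows "finite (\<Union>e\<in>E. \<epsilon> e)" "card (\<Union>e\<in>E. \<epsilon> e) \<le> 2 * card E"
proof -
  have ends: "finite (\<epsilon> e) \<and> card (\<epsilon> e) \<le> 2" if "e \<in> E" for e
    using assms(2) that by (auto simp: graph_on_def card_insert_if)
  with assms(1) show "finite (\<Union>e\<in>E. \<epsilon> e)" by simp
  have "card (\<Union>e\<in>E. \<epsilon> e) \<le> (\<Sum>e\<in>E. card (\<epsilon> e))"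
    by (rule card_UN_le[OF assms(1)])
  also have "\<dots> \<le> 2 * card E"
    using sum_bounded_above[of E "\<lambda>e. card (\<epsilon> e)" 2] ends by simp
  finally show "card (\<Union>e\<in>E. \<epsilon> e) \<le> 2 * card E" .
qed

lemma ex_relabelled_graph:
  assumes "finite E" "graph_on V E \<epsilon>"
  shows "\<exists>\<epsilon>'. graph_on {..<2 * card E} E \<epsilon>' \<and> (\<forall>S\<subseteq>E. even_subsets \<epsilon>' S = even_subsets \<epsilon> S)"
proof -
  define U where "U = (\<Union>e\<in>E. \<epsilon> e)"
  have U: "finite U" "card U \<le> 2 * card E"
    using card_Union_ends_le[OF assms] by (simp_all add: U_def)
  obtain \<phi> where "bij_betw \<phi> U {0..<card U}"
    using ex_bij_betw_finite_nat[OF U(1)] by blast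
  then have inj: "inj_on \<phi> U" and image: "\<phi> ` U \<subseteq> {..<2 * card E}"
    using U(2) by (auto simp: bij_betw_def)
  have "\<exists>u\<in>{..<2 * card E}. \<exists>w\<in>{..<2 * card E}. \<phi> ` \<epsilon> e = {u, w}" if edge: "e \<in> E" for e
  proof -
    obtain u w where "\<epsilon> e = {u, w}" using assms(2) edge unfolding graph_on_def by blast
    moreover from this edge have "u \<in> U" "w \<in> U" unfolding U_def by blast+
    then have "\<phi> u \<in> {..<2 * card E}" "\<phi> w \<in> {..<2 * card E}" using image by blast+
    ultimately show ?thesis by (metis image_empty image_insert)
  qed
  then have "graph_on {..<2 * card E} E (\<lambda>e. \<phi> ` \<epsilon> e)"
    by (simp add: graph_on_def)
  moreover have "even_set (\<lambda>e. \<phi> ` \<epsilon> e) T \<longleftrightarrow> even_set \<epsilon> T" if "T \<subseteq> E" for T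
    using that by (intro even_set_image[OF inj]) (auto simp: U_def)
  then have "even_subsets (\<lambda>e. \<phi> ` \<epsilon> e) S = even_subsets \<epsilon> S" if "S \<subseteq> E" for S
    using that by (auto simp: even_subsets_def)
  ultimately show ?thesis by blast
qed

lemma graphic_matroid_forest:
  assumes "graphic_matroid E Ind"
  shows "\<exists>\<epsilon> :: 'e \<Rightarrow> nat set. graph_on {..<2 * card E} E \<epsilon> \<and> (\<forall>S. Ind S \<longleftrightarrow> S \<subseteq> E \<and> forest \<epsilon> S)"
proof -
  obtain G :: "(nat, 'e) mgraph" where G: "wf_mgraph G" "edges G = E"
    and Ind: "\<And>S. Ind S \<longleftrightarrow> S \<subseteq> E \<and> \<not> contains_cycle G S"
    using assms unfolding graphic_matroid_def by blast
  have "finite E" "graph_on (verts G) E (ends G)"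
    using G wf_mgraph_graph_on[OF G(1)] by (auto simp: wf_mgraph_def)
  then obtain \<epsilon> :: "'e \<Rightarrow> nat set" where "graph_on {..<2 * card E} E \<epsilon>"
    and "\<And>S. S \<subseteq> E \<Longrightarrow> even_subsets \<epsilon> S = even_subsets (ends G) S"
    using ex_relabelled_graph by metis
  with Ind contains_cycle_iff_not_forest[OF G(1)] G(2) show ?thesis
    unfolding forest_def by metis
qed

section \<open>Counting closed trails in graphs of large girth\<close>

definition closed_trails :: "('e \<Rightarrow> 'v set) \<Rightarrow> 'e set \<Rightarrow> 'e set set" where
  "closed_trails \<epsilon> E = {set es |es p. closed_trail \<epsilon> p es \<and> set es \<subseteq> E}"

definition short_links :: "('e \<Rightarrow> 'v set) \<Rightarrow> 'e set \<Rightarrow> 'v set \<Rightarrow> nat \<Rightarrow> 'e set set" where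
  "short_links \<epsilon> E V k = (\<Union>(u, w)\<in>V \<times> V. {P. P \<subseteq> E \<and> card P < k \<and> joins \<epsilon> P u w})"

definition trail_pieces :: "('e \<Rightarrow> 'v set) \<Rightarrow> 'e set \<Rightarrow> 'v set \<Rightarrow> nat \<Rightarrow> 'e set set" where
  "trail_pieces \<epsilon> E V k = insert {} ((\<lambda>(e, P). insert e P) ` (E \<times> short_links \<epsilon> E V k))"

lemma closed_trails_subset_even_subsets: "closed_trails \<epsilon> E \<subseteq> even_subsets \<epsilon> E"
  by (auto simp: closed_trails_def even_subsets_def closed_trail_even_set)
     (simp add: closed_trail_def)

lemma finite_closed_trails: "finite E \<Longrightarrow> finite (closed_trails \<epsilon> E)"
  by (rule finite_subset[of _ "Pow E"]) (auto simp: closed_trails_def)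

lemma joins_unique:
  assumes "girth_ge \<epsilon> E g" "P \<subseteq> E" "P' \<subseteq> E" "joins \<epsilon> P u w" "joins \<epsilon> P' u w"
    and "card P + card P' < g"
  shows "P = P'"
proof (rule ccontr)
  assume "P \<noteq> P'"
  then have "sym_diff P P' \<in> even_subsets \<epsilon> E"
    using assms(2-5) by (intro even_subsetsI joins_sym_diff) auto
  then have "g \<le> card (sym_diff P P')"
    using assms(1) by (simp add: girth_ge_def)
  also have "\<dots> \<le> card (P - P') + card (P' - P)" by (rule card_Un_le)
  also have "\<dots> \<le> card P + card P'"
    using assms(4,5) by (intro add_mono card_mono) (auto simp: joins_def)
  finally show False using assms(6) by simp
qed

lemma card_short_links:
  assumes "girth_ge \<epsilon> E g" "2 * k < g + 2" "finite E" "finite V"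
  shows "finite (short_links \<epsilon> E V k)" "card (short_links \<epsilon> E V k) \<le> (card V)\<^sup>2"
proof -
  let ?links = "\<lambda>(u, w). {P. P \<subseteq> E \<and> card P < k \<and> joins \<epsilon> P u w}"
  have finite: "finite (?links uw)" for uw
    using assms(3) by (auto simp: case_prod_beta intro: finite_subset[of _ "Pow E"])
  then show "finite (short_links \<epsilon> E V k)"
    unfolding short_links_def using assms(4) by (intro finite_UN_I) auto
  have "card (?links uw) \<le> 1" for uw
  proof -
    have "P = P'" if "P \<in> ?links uw" "P' \<in> ?links uw" for P P'
      using that assms(2) by (intro joins_unique[OF assms(1), of P P' "fst uw" "snd uw"])
        (auto simp: case_prod_beta)
    then show ?thesis
      using finite by (simp add: card_le_Suc0_iff_eq)
  qed
  then have "(\<Sum>uw\<in>V \<times> V. card (?links uw)) \<le> card (V \<times> V)"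
    using sum_bounded_above[of "V \<times> V" "\<lambda>uw. card (?links uw)" 1] by simp
  then show "card (short_links \<epsilon> E V k) \<le> (card V)\<^sup>2"
    using card_UN_le[of "V \<times> V" ?links] assms(4)
    by (simp add: short_links_def card_cartesian_product power2_eq_square)
qed

lemma card_trail_pieces:
  assumes "girth_ge \<epsilon> E g" "2 * k < g + 2" "finite E" "finite V"
  shows "finite (trail_pieces \<epsilon> E V k)" "card (trail_pieces \<epsilon> E V k) \<le> Suc (card E * (card V)\<^sup>2)"
proof -
  note links = card_short_links[OF assms]
  let ?I = "(\<lambda>(e, P). insert e P) ` (E \<times> short_links \<epsilon> E V k)"
  have "card ?I \<le> card (E \<times> short_links \<epsilon> E V k)"
    using links(1) assms(3) by (intro card_image_le) auto
  also have "\<dots> \<le> card E * (card V)\<^sup>2"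
    using links(2) by (simp add: card_cartesian_product)
  finally show "card (trail_pieces \<epsilon> E V k) \<le> Suc (card E * (card V)\<^sup>2)"
    unfolding trail_pieces_def using links(1) assms(3) by (simp add: card_insert_if)
  show "finite (trail_pieces \<epsilon> E V k)"
    unfolding trail_pieces_def using links(1) assms(3) by simp
qed

lemma trail_take_mem_trail_pieces:
  assumes "trail \<epsilon> p es" "set es \<subseteq> E" "graph_on V E \<epsilon>" "0 < k"
  shows "set (take k es) \<in> trail_pieces \<epsilon> E V k"
proof (cases es)
  case Nil
  then show ?thesis by (simp add: trail_pieces_def)
next
  case (Cons e fs)
  let ?l = "length (take (k - 1) fs)"
  have "trail \<epsilon> (\<lambda>i. p (i + 1)) (take (k - 1) fs)"
    using trail_take[OF trail_drop[OF assms(1), of 1]] by (simp add: Cons)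
  from trail_joins[OF this] have "joins \<epsilon> (set (take (k - 1) fs)) (p 1) (p (?l + 1))"
    by simp
  moreover have "p 1 \<in> V" "p (?l + 1) \<in> V"
    using trail_vertex_mem[OF assms(1) graph_on_subset[OF assms(3,2)]] Cons by simp_all
  moreover have "set (take (k - 1) fs) \<subseteq> E"
    using assms(2) set_take_subset[of "k - 1" fs] by (auto simp: Cons)
  moreover have "card (set (take (k - 1) fs)) < k"
    using card_length[of "take (k - 1) fs"] assms(4) unfolding length_take by linarith
  ultimately have "set (take (k - 1) fs) \<in> short_links \<epsilon> E V k"
    by (auto simp: short_links_def)
  moreover have "set (take k es) = insert e (set (take (k - 1) fs))"
    using assms(4) by (simp add: Cons take_Cons')
  ultimately show ?thesis
    using assms(2) by (auto simp: trail_pieces_def Cons)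
qed

lemma trail_eq_Union_trail_pieces:
  assumes "trail \<epsilon> p es" "set es \<subseteq> E" "length es \<le> r * k" and graph: "graph_on V E \<epsilon>"
  shows "\<exists>L. length L = r \<and> set L \<subseteq> trail_pieces \<epsilon> E V k \<and> set es = \<Union>(set L)"
  using assms(1-3)
proof (induction r arbitrary: p es)
  case (Suc r)
  show ?case
  proof (cases "k = 0")
    case True
    then show ?thesis
      using Suc.prems by (intro exI[of _ "replicate (Suc r) {}"]) (auto simp: trail_pieces_def)
  next
    case False
    have sub: "set (drop k es) \<subseteq> E" using Suc.prems(2) set_drop_subset by fastforce
    have "length (drop k es) \<le> r * k" using Suc.prems(3) by simp
    from Suc.IH[OF trail_drop[OF Suc.prems(1)] sub this] obtain L where
      L: "length L = r" "set L \<subseteq> trail_pieces \<epsilon> E V k" "set (drop k es) = \<Union>(set L)"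
      by metis
    have "set (take k es) \<in> trail_pieces \<epsilon> E V k"
      using trail_take_mem_trail_pieces[OF Suc.prems(1,2) graph] False by simp
    moreover have "set es = set (take k es) \<union> set (drop k es)"
      by (metis append_take_drop_id set_append)
    ultimately show ?thesis
      using L by (intro exI[of _ "set (take k es) # L"]) simp
  qed
qed simp

text \<open>Cut a closed trail into pieces of about half the girth: apart from its first edge, each piece is
  determined by its two end vertices.\<close>

lemma card_closed_trails:
  assumes "girth_ge \<epsilon> E g" "2 * k < g + 2" "finite E" "finite V" "graph_on V E \<epsilon>"
  shows "card {T \<in> closed_trails \<epsilon> E. card T \<le> r * k} \<le> Suc (card E * (card V)\<^sup>2) ^ r"
proof -
  let ?L = "{L. set L \<subseteq> trail_pieces \<epsilon> E V k \<and> length L = r}"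
  note pieces = card_trail_pieces[OF assms(1-4)]
  have "{T \<in> closed_trails \<epsilon> E. card T \<le> r * k} \<subseteq> (\<lambda>L. \<Union>(set L)) ` ?L"
  proof
    fix T assume "T \<in> {T \<in> closed_trails \<epsilon> E. card T \<le> r * k}"
    then obtain p es where es: "T = set es" "trail \<epsilon> p es" "set es \<subseteq> E" "card (set es) \<le> r * k"
      by (auto simp: closed_trails_def closed_trail_def)
    then have "length es \<le> r * k"
      by (simp add: trail_def distinct_card)
    from trail_eq_Union_trail_pieces[OF es(2,3) this assms(5)] show "T \<in> (\<lambda>L. \<Union>(set L)) ` ?L"
      using es(1) by blast
  qed
  moreover have "finite ?L" using pieces(1) by (rule finite_lists_length_eq)
  ultimately have "card {T \<in> closed_trails \<epsilon> E. card T \<le> r * k} \<le> card ?L"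
    by (meson card_image_le card_mono finite_imageI le_trans)
  also have "\<dots> = card (trail_pieces \<epsilon> E V k) ^ r" using pieces(1) by (rule card_lists_length_eq)
  also have "\<dots> \<le> Suc (card E * (card V)\<^sup>2) ^ r" using pieces(2) by (rule power_mono) simp
  finally show ?thesis .
qed

lemma girth_le_4_card_Diff:
  assumes "girth_ge \<epsilon> E g" "T \<in> even_subsets \<epsilon> E" "C \<in> even_subsets \<epsilon> E" "\<not> C \<subseteq> T"
    and "2 * card C \<le> 3 * g"
  shows "g \<le> 4 * card (T - C)"
proof -
  note T = even_subsetsD[OF assms(2)] and C = even_subsetsD[OF assms(3)]
  have "sym_diff T C \<in> even_subsets \<epsilon> E"
    using T C assms(4) by (intro even_subsetsI even_set_sym_diff) auto
  then have "g \<le> card (sym_diff T C)" using assms(1) by (simp add: girth_ge_def)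
  also have "\<dots> \<le> card (T - C) + card (C - T)" by (rule card_Un_le)
  finally have "g \<le> card (T - C) + card (C - T)" .
  moreover have "g \<le> card T" using assms(1,2) by (simp add: girth_ge_def)
  moreover have "card T = card (C \<inter> T) + card (T - C)"
    using card_Int_Diff[OF T(4), of C] by (simp add: Int_commute)
  moreover have "card C = card (C \<inter> T) + card (C - T)"
    by (rule card_Int_Diff[OF C(4)])
  ultimately show ?thesis using assms(5) by linarith
qed

section \<open>Random edge sets\<close>

definition isolates :: "('e \<Rightarrow> 'v set) \<Rightarrow> 'e set \<Rightarrow> 'e set \<Rightarrow> 'e \<Rightarrow> 'e set \<Rightarrow> bool" where
  "isolates \<epsilon> E C x S \<longleftrightarrow> C \<subseteq> S \<and> (\<forall>T\<in>even_subsets \<epsilon> (E \<inter> S). x \<in> T)"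

definition random_subset :: "'a set \<Rightarrow> real \<Rightarrow> 'a set pmf" where
  "random_subset A p = map_pmf (\<lambda>f. {x \<in> A. f x}) (Pi_pmf A False (\<lambda>_. bernoulli_pmf p))"

lemma set_pmf_random_subset: "set_pmf (random_subset A p) \<subseteq> Pow A"
  by (auto simp: random_subset_def)

lemma prob_random_subset_superset:
  assumes "finite A" "B \<subseteq> A" "0 \<le> p" "p \<le> 1"
  shows "measure_pmf.prob (random_subset A p) {S. B \<subseteq> S} = p ^ card B"
proof -
  let ?b = "bernoulli_pmf p" and ?T = "\<lambda>x. if x \<in> B then {True} else UNIV"
  have "(\<lambda>f. {x \<in> A. f x}) -` {S. B \<subseteq> S} = Pi A ?T"
    using assms(2) by (auto simp: Pi_def subset_eq)
  then have "measure_pmf.prob (random_subset A p) {S. B \<subseteq> S} = (\<Prod>x\<in>A. measure_pmf.prob ?b (?T x))"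
    using assms(1) by (simp add: random_subset_def measure_Pi_pmf_Pi)
  also have "\<dots> = (\<Prod>x\<in>A. if x \<in> B then p else 1)"
    using assms(3,4) by (intro prod.cong) (auto simp: measure_pmf_single)
  also have "\<dots> = p ^ card B"
    using assms(1,2) by (simp add: prod.If_cases Int_absorb1)
  finally show ?thesis .
qed

lemma ex_hitting_sequence:
  fixes D :: "'s pmf" and hits :: "'s \<Rightarrow> 'x \<Rightarrow> bool"
  assumes "finite X" and hit: "\<And>x. x \<in> X \<Longrightarrow> \<delta> \<le> measure_pmf.prob D {s. hits s x}"
    and few: "real (card X) < exp (\<delta> * real N)"
  shows "\<exists>F. (\<forall>j<N. F j \<in> set_pmf D) \<and> (\<forall>x\<in>X. \<exists>j<N. hits (F j) x)"
proof -
  define P where "P = Pi_pmf {..<N} undefined (\<lambda>_. D)"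
  define miss where "miss = (\<lambda>x. Pi {..<N} (\<lambda>_. {s. \<not> hits s x}))"
  have "measure_pmf.prob P (miss x) \<le> exp (- (\<delta> * real N))" if "x \<in> X" for x
  proof -
    have "{s. \<not> hits s x} = space D - {s. hits s x}"
      by auto
    then have "measure_pmf.prob D {s. \<not> hits s x} = 1 - measure_pmf.prob D {s. hits s x}"
      by (simp only: measure_pmf.prob_compl[of "{s. hits s x}" D] sets_measure_pmf UNIV_I)
    also have "\<dots> \<le> exp (- \<delta>)"
      using hit[OF that] exp_ge_add_one_self[of "- \<delta>"] by linarith
    finally have "measure_pmf.prob D {s. \<not> hits s x} ^ N \<le> exp (- \<delta>) ^ N"
      by (intro power_mono) simp_all
    then show ?thesis
      by (simp add: P_def miss_def measure_Pi_pmf_Pi exp_of_nat_mult[symmetric] mult.commute)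
  qed
  then have "(\<Sum>x\<in>X. measure_pmf.prob P (miss x)) \<le> real (card X) * exp (- (\<delta> * real N))"
    by (rule sum_bounded_above)
  also have "\<dots> < exp (\<delta> * real N) * exp (- (\<delta> * real N))"
    using few by (intro mult_strict_right_mono) simp_all
  finally have "(\<Sum>x\<in>X. measure_pmf.prob P (miss x)) < 1"
    by (simp add: exp_minus)
  then have "measure_pmf.prob P (\<Union>x\<in>X. miss x) \<noteq> 1"
    using measure_pmf.finite_measure_subadditive_finite[OF assms(1), of miss P] by auto
  then obtain F where F: "F \<in> set_pmf P" "F \<notin> (\<Union>x\<in>X. miss x)"
    by (metis AE_measure_pmf_iff UNIV_I measure_pmf.prob_eq_1 sets_measure_pmf)
  then have "F j \<in> set_pmf D" if "j < N" for j
    using that by (auto simp: P_def set_Pi_pmf PiE_dflt_def)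
  moreover have "\<exists>j<N. hits (F j) x" if "x \<in> X" for x
    using F(2) that by (auto simp: miss_def)
  ultimately show ?thesis by blast
qed

text \<open>The exponent 58: a closed trail that avoids \<open>x\<close> and has \<open>t\<close> edges outside \<open>C\<close> satisfies \<open>g \<le> 4 * t\<close>,
  so it has at most \<open>t + 3 * g / 2 \<le> 7 * t\<close> edges and consists of \<open>r \<le> 14 * t / g + 1\<close> pieces. There are
  at most \<open>n ^ (3 * r)\<close> such trails, and \<open>3 * (14 * t / g + 1) - 58 * t / g \<le> - 1\<close> makes their total
  weight at most \<open>1 / n\<close> for each \<open>t\<close>.\<close>

context
  fixes \<epsilon> :: "'e \<Rightarrow> 'v set" and V :: "'v set" and A E C :: "'e set" and x :: 'e
    and g n :: nat and p :: real
  assumes ground: "finite A" "E \<subseteq> A" "2 * card A \<le> n" and verts: "finite V" "card V \<le> n"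
    and graph: "graph_on V E \<epsilon>" and girth: "girth_ge \<epsilon> E g" and girth_pos: "0 < g"
    and cycle: "C \<in> even_subsets \<epsilon> E" "2 * card C \<le> 3 * g" and target: "x \<in> C"
  defines "p \<equiv> real n powr (- 58 / real g)"
begin

lemma finite_edges: "finite E" and card_edges: "2 * card E \<le> n"
  using ground card_mono[OF ground(1,2)] finite_subset by auto

lemma finite_trails: "finite (closed_trails \<epsilon> E)"
  using finite_edges by (rule finite_closed_trails)

lemma size_ge_2: "2 \<le> n"
proof -
  have "0 < card A"
    using ground(1,2) even_subsetsD(1)[OF cycle(1)] target by (auto simp: card_gt_0_iff)
  then show ?thesis using ground(3) by linarith
qed

lemma density_pos: "0 < p" and density_le_1: "p \<le> 1"
proof -
  show "0 < p" using size_ge_2 by (simp add: p_def)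
  show "p \<le> 1" using size_ge_2 powr_mono[of "- 58 / real g" 0 "real n"] by (simp add: p_def)
qed

lemma density_power: "p ^ t = real n powr (- 58 * real t / real g)"
  using size_ge_2 by (simp add: p_def powr_realpow[symmetric] powr_powr)

lemma girth_le_4_excess:
  assumes "T \<in> closed_trails \<epsilon> E" "x \<notin> T"
  shows "g \<le> 4 * card (T - C)"
  using girth_le_4_card_Diff[OF girth _ cycle(1) _ cycle(2)] closed_trails_subset_even_subsets
    assms target by blast

lemma card_avoiding_trail_le:
  assumes "T \<in> closed_trails \<epsilon> E" "x \<notin> T"
  shows "card T \<le> (14 * card (T - C) div g + 1) * ((g + 1) div 2)"
proof -
  let ?t = "card (T - C)"
  have "card (T \<inter> C) \<le> card C"
    using even_subsetsD(4)[OF cycle(1)] by (intro card_mono) auto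
  moreover have "finite T"
    using assms(1) finite_edges finite_subset by (auto simp: closed_trails_def)
  ultimately have "card T \<le> card C + ?t"
    using card_Int_Diff[of T C] by simp
  then have "2 * card T \<le> 14 * ?t"
    using girth_le_4_excess[OF assms] cycle(2) by linarith
  also have "14 * ?t \<le> (14 * ?t div g + 1) * g"
    using dividend_less_div_times[OF girth_pos, of "14 * ?t"] by simp
  also have "\<dots> \<le> (14 * ?t div g + 1) * (2 * ((g + 1) div 2))"
    by (intro mult_left_mono) auto
  finally show ?thesis by (simp only: mult.left_commute mult_le_cancel1)
qed

lemma card_avoiding_trails_of_excess:
  "card {T \<in> closed_trails \<epsilon> E. x \<notin> T \<and> card (T - C) = t} \<le> n ^ (3 * (14 * t div g + 1))"
    (is "card ?A \<le> _")
proof -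
  let ?r = "14 * t div g + 1" and ?k = "(g + 1) div 2"
  have "card ?A \<le> card {T \<in> closed_trails \<epsilon> E. card T \<le> ?r * ?k}"
    using finite_trails card_avoiding_trail_le by (intro card_mono) auto
  also have "\<dots> \<le> Suc (card E * (card V)\<^sup>2) ^ ?r"
    using girth finite_edges verts(1) graph by (intro card_closed_trails[where g = g]) auto
  also have "\<dots> \<le> (n ^ 3) ^ ?r"
  proof (rule power_mono)
    have "2 * (card E * (card V)\<^sup>2) \<le> n * n\<^sup>2"
      using mult_mono[OF card_edges power_mono[OF verts(2)], of 2] by simp
    moreover have "2 ^ 3 \<le> n ^ 3" using size_ge_2 by (rule power_mono) simp
    ultimately show "Suc (card E * (card V)\<^sup>2) \<le> n ^ 3"
      by (simp add: power2_eq_square power3_eq_cube)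
  qed simp
  finally show ?thesis by (simp only: power_mult)
qed

lemma sum_avoiding_trails_of_excess:
  "(\<Sum>T | T \<in> closed_trails \<epsilon> E \<and> x \<notin> T \<and> card (T - C) = t. p ^ card (T - C)) \<le> 1 / n"
    (is "sum _ ?A \<le> _")
proof (cases "?A = {}")
  case True
  show ?thesis unfolding True by simp
next
  case False
  then have "g \<le> 4 * t"
    using girth_le_4_excess by auto
  then have "1 \<le> 4 * (real t / g)"
    using girth_pos by (simp add: field_simps)
  moreover define r where "r = 14 * t div g + 1"
  have "real r \<le> 14 * (real t / g) + 1"
    using of_nat_div_le_of_nat[of "14 * t" g] by (simp add: r_def)
  ultimately have exponent: "real (3 * r) + (- 58 * real t / g) \<le> - 1"
    by simp
  have "(\<Sum>T\<in>?A. p ^ card (T - C)) = card ?A * p ^ t"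
    by simp
  also have "\<dots> \<le> real (n ^ (3 * r)) * p ^ t"
    using card_avoiding_trails_of_excess[of t] density_pos
    unfolding r_def by (intro mult_right_mono of_nat_mono) simp_all
  also have "\<dots> = real n powr (3 * r) * real n powr (- 58 * real t / g)"
    using size_ge_2 by (simp add: density_power powr_realpow[symmetric])
  also have "\<dots> = real n powr (3 * r + (- 58 * real t / g))"
    by (rule powr_add[symmetric])
  also have "\<dots> \<le> real n powr - 1"
    using exponent size_ge_2 by (intro powr_mono) simp_all
  also have "\<dots> = 1 / n"
    using size_ge_2 by (simp add: powr_minus_divide)
  finally show ?thesis .
qed

lemma sum_avoiding_trails:
  "(\<Sum>T | T \<in> closed_trails \<epsilon> E \<and> x \<notin> T. p ^ card (T - C)) \<le> 1 / 2"
proof -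
  let ?T = "{T \<in> closed_trails \<epsilon> E. x \<notin> T}"
  have "card (T - C) \<in> {1..card E}" if T: "T \<in> ?T" for T
  proof -
    have "T - C \<subseteq> E" using T by (auto simp: closed_trails_def)
    then have "card (T - C) \<le> card E" using finite_edges by (intro card_mono)
    moreover have "g \<le> 4 * card (T - C)" using T girth_le_4_excess by auto
    ultimately show ?thesis using girth_pos by auto
  qed
  then have "(\<Sum>T\<in>?T. p ^ card (T - C))
      = (\<Sum>t\<in>{1..card E}. \<Sum>T | T \<in> ?T \<and> card (T - C) = t. p ^ card (T - C))"
    using finite_trails by (intro sum.group[symmetric]) auto
  also have "\<dots> \<le> (\<Sum>t\<in>{1..card E}. 1 / n)"
    using sum_avoiding_trails_of_excess by (intro sum_mono) (simp add: conj_assoc)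
  also have "\<dots> \<le> 1 / 2"
    using card_edges size_ge_2 by (simp add: field_simps flip: of_nat_mult of_nat_le_iff)
  finally show ?thesis .
qed

lemma isolates_or_superset_of_avoiding_trail:
  assumes "C \<subseteq> S" "\<not> isolates \<epsilon> E C x S"
  shows "\<exists>T\<in>closed_trails \<epsilon> E. x \<notin> T \<and> C \<union> T \<subseteq> S"
proof -
  obtain T where T: "T \<in> even_subsets \<epsilon> (E \<inter> S)" "x \<notin> T"
    using assms by (auto simp: isolates_def)
  then obtain q es where "closed_trail \<epsilon> q es" "set es \<subseteq> T"
    using even_subset_contains_closed_trail[OF _ graph_on_subset[OF graph Int_lower1]] by metis
  with T even_subsetsD(1)[OF T(1)] assms(1) show ?thesis
    by (intro bexI[of _ "set es"]) (auto simp: closed_trails_def)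
qed

lemma density_power_card_ge: "1 / real n ^ 88 \<le> p ^ card C / 2"
proof -
  have "2 * real n ^ 87 \<le> real n * real n ^ 87"
    using size_ge_2 by (intro mult_right_mono) simp_all
  then have "2 * real n ^ 87 \<le> real n ^ 88"
    by (simp flip: power_Suc)
  then have "1 / real n ^ 88 \<le> 1 / (2 * real n ^ 87)"
    using size_ge_2 by (intro divide_left_mono) simp_all
  also have "\<dots> = real n powr (- 87) / 2"
    using size_ge_2 by (simp add: powr_minus_divide)
  also have "\<dots> \<le> p ^ card C / 2"
  proof -
    have "real (2 * card C) \<le> real (3 * g)" using cycle(2) by (simp only: of_nat_le_iff)
    then have "- 87 \<le> - 58 * real (card C) / g" using girth_pos by (simp add: field_simps)
    then show ?thesis unfolding density_power using size_ge_2 by (simp add: powr_mono)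
  qed
  finally show ?thesis .
qed

lemma prob_isolates:
  "1 / real n ^ 88 \<le> measure_pmf.prob (random_subset A p) {S. isolates \<epsilon> E C x S}"
proof -
  let ?T = "{T \<in> closed_trails \<epsilon> E. x \<notin> T}" and ?P = "measure_pmf.prob (random_subset A p)"
  let ?iso = "{S. isolates \<epsilon> E C x S}" and ?sup = "\<lambda>B. {S. B \<subseteq> S}"
  have prob_sup: "?P (?sup B) = p ^ card B" if "B \<subseteq> A" for B
    using ground(1) that density_pos density_le_1 by (intro prob_random_subset_superset) auto
  have "?P (?sup (C \<union> T)) = p ^ card C * p ^ card (T - C)" if "T \<in> ?T" for T
  proof -
    have "T \<subseteq> E" using that by (auto simp: closed_trails_def)
    then have "finite T" using finite_edges finite_subset by blast
    then have "card (C \<union> T) = card C + card (T - C)"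
      using even_subsetsD(4)[OF cycle(1)] card_Un_disjoint[of C "T - C"] by auto
    moreover have "C \<union> T \<subseteq> A" using \<open>T \<subseteq> E\<close> even_subsetsD(1)[OF cycle(1)] ground(2) by auto
    ultimately show ?thesis by (simp only: prob_sup power_add)
  qed
  then have "(\<Sum>T\<in>?T. ?P (?sup (C \<union> T))) = p ^ card C * (\<Sum>T\<in>?T. p ^ card (T - C))"
    by (simp add: sum_distrib_left)
  also have "\<dots> \<le> p ^ card C * (1 / 2)"
    using sum_avoiding_trails density_pos by (intro mult_left_mono) auto
  finally have failure: "(\<Sum>T\<in>?T. ?P (?sup (C \<union> T))) \<le> p ^ card C / 2" by simp
  have "p ^ card C = ?P (?sup C)"
    using prob_sup even_subsetsD(1)[OF cycle(1)] ground(2) by simp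
  also have "\<dots> \<le> ?P (?iso \<union> (\<Union>T\<in>?T. ?sup (C \<union> T)))"
    using isolates_or_superset_of_avoiding_trail
    by (intro measure_pmf.finite_measure_mono) (blast, simp)
  also have "\<dots> \<le> ?P ?iso + ?P (\<Union>T\<in>?T. ?sup (C \<union> T))"
    by (rule measure_Un_le) simp_all
  also have "?P (\<Union>T\<in>?T. ?sup (C \<union> T)) \<le> (\<Sum>T\<in>?T. ?P (?sup (C \<union> T)))"
    using finite_trails by (intro measure_UNION_le) simp_all
  finally have "p ^ card C \<le> ?P ?iso + p ^ card C / 2"
    using failure by simp
  with density_power_card_ge show ?thesis by linarith
qed

end

section \<open>Isolating families\<close>

definition isolates_short_cycles :: "('e \<Rightarrow> 'v set) \<Rightarrow> 'e set \<Rightarrow> nat \<Rightarrow> 'e set set \<Rightarrow> bool" where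
  "isolates_short_cycles \<epsilon> A g \<F> \<longleftrightarrow>
     (\<forall>E\<subseteq>A. girth_ge \<epsilon> E g \<longrightarrow>
        (\<forall>C\<in>even_subsets \<epsilon> E. 2 * card C \<le> 3 * g \<longrightarrow> (\<forall>x\<in>C. \<exists>S\<in>\<F>. isolates \<epsilon> E C x S)))"

text \<open>A random set isolates a given cycle with probability at least \<open>1 / (2 * m) ^ 88\<close>, and fewer than
  \<open>exp ((2 * m) ^ 4)\<close> cycles have to be isolated.\<close>

definition family_size :: "nat \<Rightarrow> nat" where
  "family_size m = (2 * m) ^ 92"

definition isolating_family :: "nat \<Rightarrow> nat \<Rightarrow> (nat \<Rightarrow> nat set) \<Rightarrow> bool" where
  "isolating_family m g F \<longleftrightarrow>
     (\<forall>\<epsilon>. graph_on {..<2 * m} {..<m} \<epsilon> \<longrightarrow> isolates_short_cycles \<epsilon> {..<m} g (F ` {..<family_size m}))"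

lemma isolates_short_cycles_cong:
  assumes "\<And>e. e \<in> A \<Longrightarrow> \<epsilon> e = \<epsilon>' e"
  shows "isolates_short_cycles \<epsilon> A g \<F> \<longleftrightarrow> isolates_short_cycles \<epsilon>' A g \<F>"
proof -
  have "even_subsets \<epsilon> E = even_subsets \<epsilon>' E" if "E \<subseteq> A" for E
    using assms that by (intro even_subsets_cong) auto
  moreover from this have "isolates \<epsilon> E C x S \<longleftrightarrow> isolates \<epsilon>' E C x S" if "E \<subseteq> A" for E C x S
    using that by (simp add: isolates_def le_infI1)
  ultimately show ?thesis
    by (simp add: isolates_short_cycles_def girth_ge_def)
qed

definition digit :: "nat \<Rightarrow> nat \<Rightarrow> nat \<Rightarrow> nat" where
  "digit b c i = c div b ^ i mod b"

definition coded_ends :: "nat \<Rightarrow> nat \<Rightarrow> nat \<Rightarrow> nat set" where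
  "coded_ends b c e = {digit b c (2 * e), digit b c (2 * e + 1)}"

lemma ex_digits:
  "(\<And>i. i < n \<Longrightarrow> f i < b) \<Longrightarrow> \<exists>c<b ^ n. \<forall>i<n. digit b c i = f i"
proof (induction n arbitrary: f)
  case (Suc n)
  have "f 0 < b" using Suc.prems by simp
  obtain c where c: "c < b ^ n" "\<And>i. i < n \<Longrightarrow> digit b c i = f (Suc i)"
    using Suc.IH[of "\<lambda>i. f (Suc i)"] Suc.prems by auto
  have "f 0 + b * c < b * Suc c" using \<open>f 0 < b\<close> by simp
  also have "\<dots> \<le> b * b ^ n" using c(1) by (intro mult_left_mono) auto
  finally have "f 0 + b * c < b ^ Suc n" by simp
  moreover have "digit b (f 0 + b * c) i = f i" if "i < Suc n" for i
    using that c(2) \<open>f 0 < b\<close> by (cases i) (auto simp: digit_def div_mult2_eq)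
  ultimately show ?case by blast
qed simp

lemma graph_on_coded_ends: "graph_on {..<2 * m} {..<m} (coded_ends (2 * m) c)"
  unfolding graph_on_def
proof
  fix e assume "e \<in> {..<m}"
  then have "digit (2 * m) c i < 2 * m" for i
    by (simp add: digit_def)
  then show "\<exists>u\<in>{..<2 * m}. \<exists>w\<in>{..<2 * m}. coded_ends (2 * m) c e = {u, w}"
    by (auto simp: coded_ends_def)
qed

lemma ex_coded_ends:
  assumes "graph_on {..<b} {..<m} \<epsilon>"
  shows "\<exists>c<b ^ (2 * m). \<forall>e<m. coded_ends b c e = \<epsilon> e"
proof -
  have "\<forall>e\<in>{..<m}. \<exists>u w. u < b \<and> w < b \<and> \<epsilon> e = {u, w}"
    using assms unfolding graph_on_def by (metis lessThan_iff)
  then obtain u w where uw: "\<And>e. e < m \<Longrightarrow> u e < b \<and> w e < b \<and> \<epsilon> e = {u e, w e}"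
    by (metis lessThan_iff)
  let ?f = "\<lambda>i. if even i then u (i div 2) else w (i div 2)"
  have "?f i < b" if "i < 2 * m" for i
    using uw[of "i div 2"] that by auto
  from ex_digits[of "2 * m" ?f, OF this] obtain c
    where "c < b ^ (2 * m)" and c: "\<And>i. i < 2 * m \<Longrightarrow> digit b c i = ?f i"
    by blast
  moreover have "coded_ends b c e = \<epsilon> e" if "e < m" for e
    using that uw c[of "2 * e"] c[of "2 * e + 1"] by (simp add: coded_ends_def)
  ultimately show ?thesis by blast
qed

lemma isolating_family_iff_coded_ends:
  "isolating_family m g F \<longleftrightarrow>
     (\<forall>c<(2 * m) ^ (2 * m).
        isolates_short_cycles (coded_ends (2 * m) c) {..<m} g (F ` {..<family_size m}))"
proof
  assume coded: "\<forall>c<(2 * m) ^ (2 * m).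
    isolates_short_cycles (coded_ends (2 * m) c) {..<m} g (F ` {..<family_size m})"
  show "isolating_family m g F"
    unfolding isolating_family_def
  proof (intro allI impI)
    fix \<epsilon> :: "nat \<Rightarrow> nat set" assume "graph_on {..<2 * m} {..<m} \<epsilon>"
    then obtain c where "c < (2 * m) ^ (2 * m)" "\<And>e. e < m \<Longrightarrow> coded_ends (2 * m) c e = \<epsilon> e"
      using ex_coded_ends by blast
    with coded show "isolates_short_cycles \<epsilon> {..<m} g (F ` {..<family_size m})"
      using isolates_short_cycles_cong[of "{..<m}" "coded_ends (2 * m) c" \<epsilon>] by auto
  qed
qed (use graph_on_coded_ends in \<open>simp add: isolating_family_def\<close>)

lemma power_self_mult_less_exp_power4:
  fixes n :: nat
  assumes "2 \<le> n"
  shows "real (n ^ n * (2 ^ n * n)) < exp (real n ^ 4)"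
proof -
  have "2 ^ n * n \<le> n ^ n * n"
    using assms by (intro mult_right_mono power_mono) auto
  then have "n ^ n * (2 ^ n * n) \<le> n ^ n * (n ^ n * n)"
    by (rule mult_left_mono) simp
  also have "\<dots> = n ^ (2 * n + 1)"
    by (simp add: power_add mult_2)
  finally have "real (n ^ n * (2 ^ n * n)) \<le> real n ^ (2 * n + 1)"
    by (simp only: of_nat_le_iff flip: of_nat_power)
  also have "\<dots> \<le> exp (real n) ^ (2 * n + 1)"
    using exp_ge_add_one_self[of "real n"] by (intro power_mono) linarith+
  also have "\<dots> = exp (real ((2 * n + 1) * n))"
    by (simp only: exp_of_nat_mult of_nat_mult)
  also have "\<dots> < exp (real n ^ 4)"
  proof -
    have "(2 * n + 1) * n < (4 * n) * n"
      using assms by (intro mult_strict_right_mono) auto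
    also have "\<dots> \<le> (n * n * n) * n"
    proof (intro mult_right_mono)
      show "4 \<le> n * n" using mult_mono[of 2 n 2 n] assms by simp
    qed simp_all
    finally have "(2 * n + 1) * n < n ^ 4"
      by (simp add: power4_eq_xxxx)
    then have "real ((2 * n + 1) * n) < real (n ^ 4)"
      by (simp only: of_nat_less_iff)
    then show ?thesis by simp
  qed
  finally show ?thesis .
qed

definition isolation_tests :: "nat \<Rightarrow> nat \<Rightarrow> (nat \<times> nat set \<times> nat set \<times> nat) set" where
  "isolation_tests m g = {(c, E, C, x). c < (2 * m) ^ (2 * m) \<and> E \<subseteq> {..<m} \<and>
     girth_ge (coded_ends (2 * m) c) E g \<and> C \<in> even_subsets (coded_ends (2 * m) c) E \<and>
     2 * card C \<le> 3 * g \<and> x \<in> C}"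

lemma isolating_family_iff_isolation_tests:
  "isolating_family m g F \<longleftrightarrow> (\<forall>(c, E, C, x)\<in>isolation_tests m g.
     \<exists>j<family_size m. isolates (coded_ends (2 * m) c) E C x (F j))"
  unfolding isolating_family_iff_coded_ends isolates_short_cycles_def isolation_tests_def bex_simps(7)
  by (simp add: Bex_def) blast

lemma isolation_tests_subset:
  "isolation_tests m g \<subseteq> {..<(2 * m) ^ (2 * m)} \<times> Pow {..<m} \<times> Pow {..<m} \<times> {..<m}"
  by (auto simp: isolation_tests_def even_subsets_def)

lemma finite_isolation_tests: "finite (isolation_tests m g)"
  using isolation_tests_subset by (rule finite_subset) simp

lemma card_isolation_tests_less: "real (card (isolation_tests m g)) < exp (real (2 * m) ^ 4)"
proof (cases "m = 0")
  case False
  let ?n = "2 * m"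
  have "card (isolation_tests m g) \<le> card ({..<?n ^ ?n} \<times> Pow {..<m} \<times> Pow {..<m} \<times> {..<m})"
    using isolation_tests_subset by (intro card_mono) auto
  also have "\<dots> = ?n ^ ?n * (2 ^ ?n * m)"
    by (simp add: card_cartesian_product card_Pow mult_2 power_add)
  also have "\<dots> \<le> ?n ^ ?n * (2 ^ ?n * ?n)" by simp
  finally have "real (card (isolation_tests m g)) \<le> real (?n ^ ?n * (2 ^ ?n * ?n))"
    by (simp only: of_nat_le_iff)
  also have "\<dots> < exp (real ?n ^ 4)"
    using False by (intro power_self_mult_less_exp_power4) simp
  finally show ?thesis .
qed (use isolation_tests_subset[of 0 g] in simp)

lemma isolating_family_exists:
  assumes "0 < g"
  shows "\<exists>F. isolating_family m g F \<and> (\<forall>j<family_size m. F j \<subseteq> {..<m})"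
proof -
  let ?n = "2 * m"
  define D where "D = random_subset {..<m} (real ?n powr (- 58 / real g))"
  define hits where "hits = (\<lambda>S (c, E, C, x). isolates (coded_ends ?n c) E C x S)"
  have hit: "1 / real ?n ^ 88 \<le> measure_pmf.prob D {S. hits S z}" if "z \<in> isolation_tests m g" for z
  proof -
    obtain c E C x where z: "z = (c, E, C, x)" by (cases z)
    with that have "E \<subseteq> {..<m}" "girth_ge (coded_ends ?n c) E g"
      "C \<in> even_subsets (coded_ends ?n c) E" "2 * card C \<le> 3 * g" "x \<in> C"
      by (simp_all add: isolation_tests_def)
    moreover from this have "graph_on {..<?n} E (coded_ends ?n c)"
      using graph_on_coded_ends by (auto intro: graph_on_subset)
    ultimately show ?thesis
      using assms prob_isolates[of "{..<m}" E ?n "{..<?n}" "coded_ends ?n c" g C x]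
      by (simp add: z hits_def D_def)
  qed
  have "real ?n ^ 4 \<le> 1 / real ?n ^ 88 * real (family_size m)"
    by (cases "m = 0") (simp_all add: family_size_def field_simps flip: power_add)
  then have few: "real (card (isolation_tests m g)) < exp (1 / real ?n ^ 88 * real (family_size m))"
    using card_isolation_tests_less[of m g] by (smt (verit) exp_le_cancel_iff)
  from ex_hitting_sequence[where hits = hits, OF finite_isolation_tests hit few]
  obtain F where F: "\<And>j. j < family_size m \<Longrightarrow> F j \<in> set_pmf D"
    "\<And>z. z \<in> isolation_tests m g \<Longrightarrow> \<exists>j<family_size m. hits (F j) z"
    by blast
  have "isolating_family m g F"
    using F(2) by (auto simp: isolating_family_iff_isolation_tests hits_def)
  moreover have "F j \<subseteq> {..<m}" if "j < family_size m" for j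
    using F(1)[OF that] set_pmf_random_subset unfolding D_def by blast
  ultimately show ?thesis by blast
qed

section \<open>Finding isolating families by exhaustive search\<close>

definition coded_family :: "nat \<Rightarrow> nat \<Rightarrow> nat set" where
  "coded_family c j = set_decode (list_code_nth c j)"

definition first_isolating_family :: "nat \<Rightarrow> nat \<Rightarrow> nat \<Rightarrow> nat set" where
  "first_isolating_family m g = coded_family (LEAST c. isolating_family m g (coded_family c))"

lemma ex_coded_isolating_family:
  assumes "0 < g"
  shows "\<exists>c. isolating_family m g (coded_family c)"
proof -
  obtain F where F: "isolating_family m g F" "\<And>j. j < family_size m \<Longrightarrow> F j \<subseteq> {..<m}"
    using isolating_family_exists[OF assms] by blast
  define c where "c = list_encode (map (set_encode \<circ> F) [0..<family_size m])"
  have "coded_family c j = F j" if "j < family_size m" for j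
  proof -
    have "finite (F j)" using F(2)[OF that] by (rule finite_subset) simp
    with that show ?thesis by (simp add: c_def coded_family_def list_code_nth)
  qed
  then have "coded_family c ` {..<family_size m} = F ` {..<family_size m}"
    by (intro image_cong) auto
  with F(1) show ?thesis
    unfolding isolating_family_def by metis
qed

lemma isolating_first_isolating_family:
  "0 < g \<Longrightarrow> isolating_family m g (first_isolating_family m g)"
  unfolding first_isolating_family_def by (rule LeastI_ex[OF ex_coded_isolating_family])

lemma computable_set_coded_ends [computable_intros]:
  "computable b \<Longrightarrow> computable c \<Longrightarrow> computable e \<Longrightarrow> computable_set (\<lambda>x. coded_ends (b x) (c x) (e x))"
  unfolding coded_ends_def digit_def by (intro computable_intros)

lemma computable_set_coded_family [computable_intros]:
  "computable c \<Longrightarrow> computable j \<Longrightarrow> computable_set (\<lambda>x. coded_family (c x) (j x))"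
  unfolding coded_family_def by (intro computable_intros)

lemma computable_family_size [computable_intros]:
  "computable m \<Longrightarrow> computable (\<lambda>x. family_size (m x))"
  unfolding family_size_def by (intro computable_intros)

lemma even_set_iff_ends:
  "even_set \<epsilon> T \<longleftrightarrow> finite T \<and> (\<forall>e\<in>T. \<forall>v\<in>\<epsilon> e. even (card {f \<in> T. v \<in> \<epsilon> f \<and> \<not> \<epsilon> f \<subseteq> {v}}))"
proof -
  have "T \<inter> star \<epsilon> v = {f \<in> T. v \<in> \<epsilon> f \<and> \<not> \<epsilon> f \<subseteq> {v}}" for v
    by (auto simp: star_def)
  moreover have "{f \<in> T. v \<in> \<epsilon> f \<and> \<not> \<epsilon> f \<subseteq> {v}} = {}" if "\<forall>e\<in>T. v \<notin> \<epsilon> e" for v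
    using that by auto
  ultimately show ?thesis
    unfolding even_set_def by (metis card.empty even_zero)
qed

lemma decidable_even_set [computable_intros]:
  assumes "computable_set (\<lambda>y. \<epsilon> (pfst y) (psnd y))" "computable_set T"
  shows "decidable (\<lambda>x. even_set (\<epsilon> x) (T x))"
proof -
  have "decidable (\<lambda>x. \<forall>e\<in>T x. \<forall>v\<in>\<epsilon> x e. even (card {f \<in> T x. v \<in> \<epsilon> x f \<and> \<not> \<epsilon> x f \<subseteq> {v}}))"
    by (intro computable_intros computable_set_comp2[where S = \<epsilon>, OF assms(1)]
        computable_set_comp[OF assms(2)])
  then show ?thesis
    by (simp add: even_set_iff_ends computable_set_finite[OF assms(2)])
qed

lemma ball_even_subsets:
  "(\<forall>T\<in>even_subsets \<epsilon> E. P T) \<longleftrightarrow> (\<forall>T\<subseteq>E. T \<noteq> {} \<and> even_set \<epsilon> T \<longrightarrow> P T)"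
  by (auto simp: even_subsets_def)

lemma decidable_girth_ge [computable_intros]:
  assumes "computable_set (\<lambda>y. \<epsilon> (pfst y) (psnd y))" "computable_set E" "computable g"
  shows "decidable (\<lambda>x. girth_ge (\<epsilon> x) (E x) (g x))"
  unfolding girth_ge_def ball_even_subsets
  by (intro computable_intros computable_set_comp2[where S = \<epsilon>, OF assms(1)]
      computable_set_comp[OF assms(2)] computable_comp[OF assms(3)])

lemma decidable_isolates [computable_intros]:
  assumes "computable_set (\<lambda>y. \<epsilon> (pfst y) (psnd y))" "computable_set E" "computable_set C"
    and "computable e" "computable_set S"
  shows "decidable (\<lambda>x. isolates (\<epsilon> x) (E x) (C x) (e x) (S x))"
  unfolding isolates_def ball_even_subsets
  by (intro computable_intros computable_set_comp2[where S = \<epsilon>, OF assms(1)]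
      assms(2,3,5)[THEN computable_set_comp] computable_comp[OF assms(4)])

lemma decidable_isolating_family [computable_intros]:
  assumes "computable m" "computable g" "computable_set (\<lambda>y. F (pfst y) (psnd y))"
  shows "decidable (\<lambda>x. isolating_family (m x) (g x) (F x))"
  unfolding isolating_family_iff_coded_ends isolates_short_cycles_def ball_even_subsets bex_simps(7)
  by (intro computable_intros computable_set_comp2[where S = F, OF assms(3)]
      assms(1,2)[THEN computable_comp])

lemma computable_set_first_isolating_family [computable_intros]:
  assumes "computable m" "computable g" "computable j" "\<And>x. 0 < g x"
  shows "computable_set (\<lambda>x. first_isolating_family (m x) (g x) (j x))"
  unfolding first_isolating_family_def
  by (intro computable_intros ex_coded_isolating_family assms assms(1,2)[THEN computable_comp])

section \<open>Pruning\<close>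

definition prune :: "('e :: linorder set \<Rightarrow> bool) \<Rightarrow> 'e set set \<Rightarrow> 'e set \<Rightarrow> 'e set" where
  "prune Ind \<F> E = {e \<in> E. \<forall>S\<in>\<F>. \<not> (Ind (E \<inter> S \<inter> {..<e}) \<and> \<not> Ind (E \<inter> S \<inter> {..e}))}"

lemma even_set_of_pruned:
  assumes Ind: "\<And>S. S \<subseteq> E \<Longrightarrow> Ind S \<longleftrightarrow> forest \<epsilon> S" and "e \<in> E" "e \<notin> prune Ind \<F> E"
  shows "\<exists>C. even_set \<epsilon> C \<and> e \<in> C \<and> C \<subseteq> {..e}"
proof -
  obtain S where "Ind (E \<inter> S \<inter> {..<e})" "\<not> Ind (E \<inter> S \<inter> {..e})"
    using assms(2,3) by (auto simp: prune_def)
  then have smaller: "even_subsets \<epsilon> (E \<inter> S \<inter> {..<e}) = {}"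
    and "even_subsets \<epsilon> (E \<inter> S \<inter> {..e}) \<noteq> {}"
    by (simp_all add: Ind le_infI1 forest_def)
  then obtain C where C: "C \<in> even_subsets \<epsilon> (E \<inter> S \<inter> {..e})" by blast
  have "e \<in> C"
  proof (rule ccontr)
    assume "e \<notin> C"
    then have "C \<subseteq> E \<inter> S \<inter> {..<e}"
      using even_subsetsD(1)[OF C] by (auto simp: less_le)
    with even_subsetsD(2,3)[OF C] have "C \<in> even_subsets \<epsilon> (E \<inter> S \<inter> {..<e})"
      by (intro even_subsetsI)
    with smaller show False by simp
  qed
  with even_subsetsD[OF C] show ?thesis by blast
qed

lemma girth_ge_prune:
  assumes Ind: "\<And>S. S \<subseteq> E \<Longrightarrow> Ind S \<longleftrightarrow> forest \<epsilon> S" and girth: "girth_ge \<epsilon> E g"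
    and isolating: "isolates_short_cycles \<epsilon> A g \<F>" "E \<subseteq> A"
  shows "girth_ge \<epsilon> (prune Ind \<F> E) (3 * g div 2 + 1)"
  unfolding girth_ge_def
proof (rule ballI, rule ccontr)
  fix C assume C: "C \<in> even_subsets \<epsilon> (prune Ind \<F> E)" and "\<not> 3 * g div 2 + 1 \<le> card C"
  have CE: "C \<in> even_subsets \<epsilon> E"
    using C by (auto simp: even_subsets_def prune_def)
  note C_fin = even_subsetsD(2,4)[OF C]
  have "2 * card C \<le> 3 * g"
    using \<open>\<not> 3 * g div 2 + 1 \<le> card C\<close> by simp
  from isolating(1)[unfolded isolates_short_cycles_def, rule_format, OF isolating(2) girth CE this]
  obtain S where S: "S \<in> \<F>" "C \<subseteq> S" "\<And>T. T \<in> even_subsets \<epsilon> (E \<inter> S) \<Longrightarrow> Max C \<in> T"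
    using Max_in[OF C_fin(2,1)] unfolding isolates_def by metis
  have "even_subsets \<epsilon> (E \<inter> S \<inter> {..<Max C}) = {}"
    using S(3) even_subsets_mono[of "E \<inter> S \<inter> {..<Max C}" "E \<inter> S" \<epsilon>]
    by (auto dest: even_subsetsD(1))
  then have "Ind (E \<inter> S \<inter> {..<Max C})"
    by (simp add: Ind le_infI1 forest_def)
  moreover have "C \<in> even_subsets \<epsilon> (E \<inter> S \<inter> {..Max C})"
    using CE S(2) C_fin by (auto simp: even_subsets_def)
  then have "\<not> Ind (E \<inter> S \<inter> {..Max C})"
    by (auto simp: Ind le_infI1 forest_def)
  ultimately have "Max C \<notin> prune Ind \<F> E"
    using S(1) by (auto simp: prune_def)
  then show False
    using Max_in[OF C_fin(2,1)] even_subsetsD(1)[OF C] by blast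
qed

primrec girth_bound :: "nat \<Rightarrow> nat" where
  "girth_bound 0 = 1"
| "girth_bound (Suc n) = 3 * girth_bound n div 2 + 1"

definition test_family :: "nat \<Rightarrow> nat \<Rightarrow> nat \<Rightarrow> nat set" where
  "test_family m n = first_isolating_family m (girth_bound n)"

primrec survivors :: "(nat set \<Rightarrow> bool) \<Rightarrow> nat \<Rightarrow> nat \<Rightarrow> nat set" where
  "survivors Ind m 0 = {..<m}"
| "survivors Ind m (Suc n) = prune Ind (test_family m n ` {..<family_size m}) (survivors Ind m n)"

lemma girth_bound_pos: "0 < girth_bound n"
  by (cases n) auto

lemma survivors_subset: "survivors Ind m n \<subseteq> {..<m}"
  by (induction n) (auto simp: prune_def)

context
  fixes Ind :: "nat set \<Rightarrow> bool" and \<epsilon> :: "nat \<Rightarrow> nat set" and m :: nat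
  assumes graph: "graph_on {..<2 * m} {..<m} \<epsilon>" and Ind: "\<And>S. Ind S \<longleftrightarrow> S \<subseteq> {..<m} \<and> forest \<epsilon> S"
begin

lemma Ind_iff_forest: "S \<subseteq> survivors Ind m n \<Longrightarrow> Ind S \<longleftrightarrow> forest \<epsilon> S"
  using Ind survivors_subset by blast

lemma girth_ge_survivors: "girth_ge \<epsilon> (survivors Ind m n) (girth_bound n)"
proof (induction n)
  case 0
  show ?case
    by (auto simp: girth_ge_def Suc_le_eq card_gt_0_iff dest: even_subsetsD)
next
  case (Suc n)
  have "isolates_short_cycles \<epsilon> {..<m} (girth_bound n) (test_family m n ` {..<family_size m})"
    using isolating_first_isolating_family[OF girth_bound_pos] graph
    by (simp add: isolating_family_def test_family_def)
  from girth_ge_prune[OF Ind_iff_forest Suc this survivors_subset] show ?case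
    by simp
qed

lemma even_set_of_removed:
  assumes "e < m" "e \<notin> survivors Ind m n"
  shows "\<exists>C. even_set \<epsilon> C \<and> e \<in> C \<and> C \<subseteq> {..e}"
  using assms(2)
proof (induction n)
  case 0
  then show ?case using assms(1) by simp
next
  case (Suc n)
  then show ?case
    using even_set_of_pruned[OF Ind_iff_forest] by (cases "e \<in> survivors Ind m n") auto
qed

lemma forest_survivors:
  assumes "m < girth_bound n"
  shows "forest \<epsilon> (survivors Ind m n)"
proof -
  have False if T: "T \<in> even_subsets \<epsilon> (survivors Ind m n)" for T
  proof -
    have "girth_bound n \<le> card T" using girth_ge_survivors T by (simp add: girth_ge_def)
    also have "\<dots> \<le> card {..<m}"
      using even_subsetsD(1)[OF T] survivors_subset[of Ind m n] by (intro card_mono) auto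
    finally show False using assms by simp
  qed
  then show ?thesis by (auto simp: forest_def)
qed

lemma matroid_basis_survivors:
  assumes "m < girth_bound n"
  shows "matroid_basis Ind (survivors Ind m n)"
  unfolding matroid_basis_def
proof (intro conjI allI impI)
  let ?B = "survivors Ind m n"
  show "Ind ?B"
    using forest_survivors[OF assms] survivors_subset by (simp add: Ind)
  fix S assume S: "Ind S \<and> ?B \<subseteq> S"
  show "S = ?B"
  proof (rule ccontr)
    assume "S \<noteq> ?B"
    then obtain e where e: "e \<in> S" "e \<notin> ?B" using S by blast
    moreover from this have "e < m" using S Ind by auto
    ultimately obtain D where "even_set \<epsilon> D" "e \<in> D" "D \<subseteq> insert e ?B"
      using even_set_eliminate[of e ?B \<epsilon>] even_set_of_removed[of _ n] by auto
    then have "D \<in> even_subsets \<epsilon> S"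
      using e(1) S by (intro even_subsetsI) auto
    then show False
      using S Ind by (auto simp: forest_def)
  qed
qed

end

section \<open>The algorithm\<close>

definition batch_index :: "nat \<Rightarrow> nat \<Rightarrow> nat \<Rightarrow> nat" where
  "batch_index m j k = j * (m + 1) + k"

definition batch :: "nat \<Rightarrow> nat \<Rightarrow> nat set \<Rightarrow> nat set list" where
  "batch m n E = map (\<lambda>q. E \<inter> test_family m n (q div (m + 1)) \<inter> {..<q mod (m + 1)})
     [0..<family_size m * (m + 1)]"

definition answer :: "bool list list \<Rightarrow> nat \<Rightarrow> nat \<Rightarrow> bool" where
  "answer h i q \<longleftrightarrow> i < length h \<and> q < length (h ! i) \<and> h ! i ! q"

text \<open>The surviving edges are read off the answers alone, so earlier queries need not be recomputed.\<close>

definition alive :: "nat \<Rightarrow> bool list list \<Rightarrow> nat set" where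
  "alive m h = {e \<in> {..<m}. \<forall>i<length h. \<forall>j<family_size m.
     \<not> (answer h i (batch_index m j e) \<and> \<not> answer h i (batch_index m j (Suc e)))}"

definition basis_algorithm :: algorithm where
  "basis_algorithm m h =
     (if m < girth_bound (length h) then Return (alive m h)
      else Query (batch m (length h) (alive m h)))"

definition transcript :: "(nat set \<Rightarrow> bool) \<Rightarrow> nat \<Rightarrow> nat \<Rightarrow> bool list list" where
  "transcript Ind m n = map (\<lambda>i. map Ind (batch m i (survivors Ind m i))) [0..<n]"

definition rounds :: "nat \<Rightarrow> nat" where
  "rounds m = (LEAST n. m < girth_bound n)"

lemma length_transcript [simp]: "length (transcript Ind m n) = n"
  by (simp add: transcript_def)

lemma transcript_Suc:
  "transcript Ind m (Suc n) = transcript Ind m n @ [map Ind (batch m n (survivors Ind m n))]"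
  by (simp add: transcript_def)

lemma batch_subset: "S \<in> set (batch m n E) \<Longrightarrow> S \<subseteq> E"
  by (auto simp: batch_def)

lemma batch_index_div_mod:
  assumes "k \<le> m"
  shows "batch_index m j k div (m + 1) = j" "batch_index m j k mod (m + 1) = k"
  using assms unfolding batch_index_def by (simp_all only: div_mult_self3 mod_mult_self3) auto

lemma batch_index_less:
  assumes "j < N" "k \<le> m"
  shows "batch_index m j k < N * (m + 1)"
proof -
  have "batch_index m j k < Suc j * (m + 1)" using assms(2) by (simp add: batch_index_def)
  also have "\<dots> \<le> N * (m + 1)" using assms(1) by (intro mult_right_mono) auto
  finally show ?thesis .
qed

lemma answer_batch:
  assumes "j < family_size m" "k \<le> m"
  shows "answer (h @ [map Ind (batch m n E)]) (length h) (batch_index m j k)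
    \<longleftrightarrow> Ind (E \<inter> test_family m n j \<inter> {..<k})"
  using batch_index_less[OF assms] batch_index_div_mod[OF assms(2)]
  by (simp add: answer_def batch_def)

lemma alive_snoc:
  "alive m (h @ [as]) = {e \<in> alive m h. \<forall>j<family_size m.
     \<not> (answer (h @ [as]) (length h) (batch_index m j e) \<and>
        \<not> answer (h @ [as]) (length h) (batch_index m j (Suc e)))}"
proof -
  have "answer (h @ [as]) i q \<longleftrightarrow> answer h i q" if "i < length h" for i q
    using that by (simp add: answer_def nth_append)
  then show ?thesis
    by (auto simp: alive_def less_Suc_eq)
qed

lemma alive_transcript: "alive m (transcript Ind m n) = survivors Ind m n"
proof (induction n)
  case 0
  show ?case by (auto simp: alive_def transcript_def)
next
  case (Suc n)
  let ?E = "survivors Ind m n" and ?h = "transcript Ind m n"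
  have "alive m (transcript Ind m (Suc n)) = {e \<in> ?E. \<forall>j<family_size m.
      \<not> (Ind (?E \<inter> test_family m n j \<inter> {..<e}) \<and> \<not> Ind (?E \<inter> test_family m n j \<inter> {..<Suc e}))}"
    using survivors_subset[of Ind m n] answer_batch[of _ m _ ?h Ind n ?E]
    by (auto simp: transcript_Suc alive_snoc Suc)
  then show ?case
    by (auto simp: prune_def lessThan_Suc_atMost)
qed

lemma run_basis_algorithm:
  assumes "m < girth_bound n" "\<And>i. i < n \<Longrightarrow> \<not> m < girth_bound i"
  shows "run basis_algorithm m Ind (transcript Ind m n) (survivors Ind m n)"
  unfolding run_def
proof (intro conjI allI impI)
  fix i assume "i < length (transcript Ind m n)"
  then have i: "i < n" by simp
  show "\<exists>qs. basis_algorithm m (take i (transcript Ind m n)) = Query qs \<and>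
      (\<forall>S\<in>set qs. S \<subseteq> {..<m}) \<and> transcript Ind m n ! i = map Ind qs"
  proof (intro exI conjI ballI)
    have "take i (transcript Ind m n) = transcript Ind m i"
      using i by (simp add: transcript_def take_map)
    then show "basis_algorithm m (take i (transcript Ind m n)) = Query (batch m i (survivors Ind m i))"
      using assms(2)[OF i] by (simp add: basis_algorithm_def alive_transcript)
    show "transcript Ind m n ! i = map Ind (batch m i (survivors Ind m i))"
      using i by (simp add: transcript_def)
    show "S \<subseteq> {..<m}" if "S \<in> set (batch m i (survivors Ind m i))" for S
      using batch_subset[OF that] survivors_subset by blast
  qed
qed (use assms(1) in \<open>simp add: basis_algorithm_def alive_transcript\<close>)

section \<open>Uniformity\<close>

lemma computable_sum_encode_Inl [computable_intros]:
  "computable f \<Longrightarrow> computable (\<lambda>x. sum_encode (Inl (f x)))"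
  unfolding sum_encode_def sum.case by (intro computable_intros)

lemma computable_sum_encode_Inr [computable_intros]:
  "computable f \<Longrightarrow> computable (\<lambda>x. sum_encode (Inr (f x)))"
  unfolding sum_encode_def sum.case by (intro computable_intros)

lemma computable_girth_bound [computable_intros]:
  "computable f \<Longrightarrow> computable (\<lambda>x. girth_bound (f x))"
  unfolding girth_bound_def by (intro computable_intros)

lemma computable_set_test_family [computable_intros]:
  "computable m \<Longrightarrow> computable n \<Longrightarrow> computable j \<Longrightarrow> computable_set (\<lambda>x. test_family (m x) (n x) (j x))"
  unfolding test_family_def by (intro computable_intros girth_bound_pos)

definition coded_answer :: "nat \<Rightarrow> nat \<Rightarrow> nat \<Rightarrow> bool" where
  "coded_answer c i q \<longleftrightarrow> list_code_nth (list_code_nth c i) q = 1"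

definition coded_alive :: "nat \<Rightarrow> nat \<Rightarrow> nat set" where
  "coded_alive m c = {e \<in> {..<m}. \<forall>i<list_code_length c. \<forall>j<family_size m.
     \<not> (coded_answer c i (batch_index m j e) \<and> \<not> coded_answer c i (batch_index m j (Suc e)))}"

definition coded_action :: "nat \<Rightarrow> nat \<Rightarrow> nat" where
  "coded_action m c =
     (if m < girth_bound (list_code_length c) then sum_encode (Inr (set_encode (coded_alive m c)))
      else sum_encode (Inl (list_encode (map (\<lambda>q. set_encode (coded_alive m c \<inter>
          test_family m (list_code_length c) (q div (m + 1)) \<inter> {..<q mod (m + 1)}))
        [0..<family_size m * (m + 1)]))))"

lemma computable_set_coded_alive [computable_intros]:
  assumes "computable m" "computable c"
  shows "computable_set (\<lambda>x. coded_alive (m x) (c x))"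
  unfolding coded_alive_def coded_answer_def batch_index_def
  by (intro computable_intros assms[THEN computable_comp])

lemma computable_coded_action: "computable (\<lambda>x. coded_action (pfst x) (psnd x))"
  unfolding coded_action_def by (intro computable_intros)

lemma decode_coded_action:
  fixes h :: "bool list list"
  defines "c \<equiv> list_encode (map (\<lambda>as. list_encode (map of_bool as)) h)"
  shows "decode_action (coded_action m c) = basis_algorithm m h"
proof -
  have "list_code_nth c i = list_encode (if i < length h then map of_bool (h ! i) else [])" for i
    by (simp add: c_def list_code_nth)
  then have "coded_answer c i q \<longleftrightarrow> answer h i q" for i q
    by (simp add: coded_answer_def answer_def list_code_nth)
  moreover have len: "list_code_length c = length h"
    by (simp add: c_def list_code_length)
  ultimately have alive: "coded_alive m c = alive m h"
    by (simp add: coded_alive_def alive_def)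
  have fin: "finite (alive m h)" by (simp add: alive_def)
  have "finite S" if "S \<in> set (batch m n (alive m h))" for S n
    using batch_subset[OF that] fin by (rule finite_subset)
  then have "map set_decode (map set_encode (batch m n (alive m h))) = batch m n (alive m h)" for n
    unfolding map_map by (intro map_idI) simp
  moreover have "coded_action m c =
      (if m < girth_bound (length h) then sum_encode (Inr (set_encode (alive m h)))
       else sum_encode (Inl (list_encode (map set_encode (batch m (length h) (alive m h))))))"
    by (simp add: coded_action_def len alive batch_def comp_def)
  ultimately show ?thesis
    using fin by (simp add: basis_algorithm_def decode_action_def del: map_map)
qed

lemma uniform_basis_algorithm: "uniform basis_algorithm"
  unfolding uniform_def
proof (intro exI conjI allI)
  show "computable (\<lambda>x. coded_action (pfst x) (psnd x))" by (rule computable_coded_action)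
  show "basis_algorithm m h =
      decode_action (coded_action (pfst (encode_input m h)) (psnd (encode_input m h)))" for m h
    by (simp add: encode_input_def decode_coded_action)
qed

section \<open>Complexity\<close>

lemma power2_le_girth_bound: "2 ^ k \<le> girth_bound (2 * k)"
  by (induction k) auto

lemma less_girth_bound_rounds: "m < girth_bound (rounds m)"
proof -
  have "m < girth_bound (2 * m)" using power2_le_girth_bound[of m] less_exp[of m] by linarith
  then show ?thesis unfolding rounds_def by (rule LeastI)
qed

lemma rounds_le_log:
  assumes "0 < m"
  shows "real (rounds m) \<le> 2 * log 2 (real m) + 2"
proof -
  define k where "k = Suc (nat \<lfloor>log 2 (real m)\<rfloor>)"
  have "0 \<le> log 2 (real m)" using assms by simp
  then have k: "log 2 (real m) < real k" "real k \<le> log 2 (real m) + 1"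
    unfolding k_def by linarith+
  then have "real m < real (2 ^ k)"
    using assms by (simp add: log_less_iff powr_realpow)
  then have "m < 2 ^ k" by (simp only: of_nat_less_iff)
  also have "\<dots> \<le> girth_bound (2 * k)" by (rule power2_le_girth_bound)
  finally have "rounds m \<le> 2 * k" unfolding rounds_def by (rule Least_le)
  then show ?thesis using k(2) by linarith
qed

lemma rounds_bigo: "(\<lambda>m. real (rounds m)) \<in> O(\<lambda>m. log 2 (real m) * log 2 (log 2 (real m)))"
proof (rule landau_o.big_trans)
  show "(\<lambda>m. real (rounds m)) \<in> O(\<lambda>m. 2 * log 2 (real m) + 2)"
  proof (intro landau_o.big_mono eventually_mono[OF eventually_gt_at_top[of 0]])
    show "norm (real (rounds m)) \<le> norm (2 * log 2 (real m) + 2)" if "0 < m" for m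
      using rounds_le_log[OF that] by simp
  qed
  show "(\<lambda>m. 2 * log 2 (real m) + 2) \<in> O(\<lambda>m. log 2 (real m) * log 2 (log 2 (real m)))"
    by real_asymp
qed

lemma batch_size_bigo: "(\<lambda>m. real (family_size m * (m + 1))) \<in> O(\<lambda>m. real m ^ 93)"
  unfolding family_size_def by real_asymp

theorem theorem1p4:
  "\<exists>(A :: algorithm) (R :: nat \<Rightarrow> nat) (P :: nat \<Rightarrow> nat) (d :: nat).
     uniform A \<and>
     (\<lambda>m. real (R m)) \<in> O(\<lambda>m. log 2 (real m) * log 2 (log 2 (real m))) \<and>
     (\<lambda>m. real (P m)) \<in> O(\<lambda>m. real m ^ d) \<and>
     (\<forall>(m :: nat) (Ind :: nat set \<Rightarrow> bool). graphic_matroid {..<m} Ind \<longrightarrow>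
        (\<exists>h B. run A m Ind h B \<and> matroid_basis Ind B \<and>
           length h \<le> R m \<and> (\<forall>as\<in>set h. length as \<le> P m)))"
proof (intro exI conjI allI impI)
  show "uniform basis_algorithm" by (rule uniform_basis_algorithm)
  show "(\<lambda>m. real (rounds m)) \<in> O(\<lambda>m. log 2 (real m) * log 2 (log 2 (real m)))"
    by (rule rounds_bigo)
  show "(\<lambda>m. real (family_size m * (m + 1))) \<in> O(\<lambda>m. real m ^ 93)"
    by (rule batch_size_bigo)
  fix m :: nat and Ind :: "nat set \<Rightarrow> bool"
  let ?h = "transcript Ind m (rounds m)" and ?B = "survivors Ind m (rounds m)"
  assume "graphic_matroid {..<m} Ind"
  then obtain \<epsilon> :: "nat \<Rightarrow> nat set"
    where "graph_on {..<2 * m} {..<m} \<epsilon>" "\<And>S. Ind S \<longleftrightarrow> S \<subseteq> {..<m} \<and> forest \<epsilon> S"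
    using graphic_matroid_forest[of "{..<m}" Ind] by auto
  then show "matroid_basis Ind ?B"
    using less_girth_bound_rounds by (rule matroid_basis_survivors)
  show "run basis_algorithm m Ind ?h ?B"
    using less_girth_bound_rounds not_less_Least unfolding rounds_def by (rule run_basis_algorithm)
  show "length ?h \<le> rounds m" by simp
  show "\<forall>as\<in>set ?h. length as \<le> family_size m * (m + 1)"
    by (auto simp: transcript_def batch_def)
qed

end
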